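(* Let $V$ and $W$ be real vector spaces of dimensions $n\geq2$ and $m\geq1$ respectively, equipped with positive definite inner products, let $\beta\colon V\times V\to W$ be a symmetric bilinear form and let $c\in\mathbb{R}$. Then: (i) If $n\geq 3$, then for every $k\in\{1,\dots,n-1\}$ the inequality $$\boldsymbol{\rho}_{c,k}(\beta)\leq c+\mathsf{H}_\beta^2-\boldsymbol{\rho}^\perp(\beta)$$ holds. Equality holds for some $k\in\{1,\dots,n-1\}$ if and only if $\beta$ is umbilical. (ii) For every $\lambda\in[0,1)$ the inequality $$\boldsymbol{\rho}_{c}(\beta)\leq c+\mathsf{H}_\beta^2-\lambda\boldsymbol{\rho}^\perp(\beta)$$ holds. Equality holds for some $\lambda\in[0,1)$ if and only if $\beta$ is umbilical.
   Context: For a symmetric bilinear form $\beta\colon V\times V\to W$ and $\xi\in W$, the formal shape operator $A_\xi(\beta)\in\mathrm{End}(V)$ is the self-adjoint endomorphism defined by $\langle A_\xi(\beta)x,y\rangle=\langle\beta(x,y),\xi\rangle$. Put $\mathcal{H}_\beta=\frac1n\mathrm{tr}\,\beta=\frac1n\sum_i\beta(e_i,e_i)$ and $\mathsf{H}_\beta=\|\mathcal{H}_\beta\|$, where $\{e_i\}_{1\le i\le n}$ is an orthonormal basis of $V$. The form $\beta$ is umbilical if $\beta=\langle\cdot,\cdot\rangle\mathcal{H}_\beta$. The formal Ricci tensor is $\mathsf{Ric}_c(\beta)(x,y)=\sum_i\mathsf{R}_c(\beta)(e_i,x,e_i,y)$, where $$\mathsf{R}_c(\beta)(x_1,x_2,x_3,x_4)=c\big(\langle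 x_1,x_3\rangle\langle x_2,x_4\rangle-\langle x_1,x_4\rangle\langle x_2,x_3\rangle\big)+\langle\beta(x_1,x_3),\beta(x_2,x_4)\rangle-\langle\beta(x_1,x_4),\beta(x_2,x_3)\rangle.$$ Let $\boldsymbol{\lambda}_{c,1}(\beta)\leq\dots\leq\boldsymbol{\lambda}_{c,n}(\beta)$ be the eigenvalues of the self-adjoint operator $\mathsf{T}_c(\beta)$ on $V$ determined by $\langle\mathsf{T}_c(\beta)x,y\rangle=\frac{1}{n-1}\mathsf{Ric}_c(\beta)(x,y)$. For $1\leq k\leq n$ set $\boldsymbol{\rho}_{c,k}(\beta)=\frac1k\sum_{i=1}^k\boldsymbol{\lambda}_{c,i}(\beta)$, and $\boldsymbol{\rho}_c(\beta)=\boldsymbol{\rho}_{c,n}(\beta)$. Finally, $$\boldsymbol{\rho}^\perp(\beta)=\frac{1}{n(n-1)}\Big(\sum_{i,j=1}^n\sum_{a,b=1}^m\big\langle[A_{\xi_a}(\beta),A_{\xi_b}(\beta)]e_i,e_j\big\rangle^2\Big)^{1/2},$$ where $\{\xi_a\}_{1\le a\le m}$ is an orthonormal basis of $W$ and $[A,B]=A\circ B-B\circ A$. *)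

theory Defs
  imports "HOL-Analysis.Analysis"
begin

text \<open>
  A real vector space of dimension \<open>n\<close> with a positive definite inner product is a type of class
  \<open>euclidean_space\<close> with \<open>DIM('a) = n\<close>; this class only allows \<open>DIM('a) \<ge> 1\<close>. Traces and sums over
  an orthonormal basis are taken over \<open>Basis\<close>; \<open>sum_orthonormal_basis\<close> shows that another
  orthonormal basis gives the same values.
\<close>

lemma sum_orthonormal_basis:
  fixes \<beta> :: "'a::euclidean_space \<Rightarrow> 'a \<Rightarrow> 'b::euclidean_space"
  assumes bil: "bilinear \<beta>" and card: "card B = DIM('a)"
    and orth: "pairwise orthogonal B" and unit: "\<And>e. e \<in> B \<Longrightarrow> norm e = 1"
  shows "(\<Sum>e\<in>B. \<beta> e e) = (\<Sum>e\<in>Basis. \<beta> e e)"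
proof -
  have fin: "finite B"
    using card DIM_positive[where 'a='a] by (metis card.infinite less_irrefl)
  have "independent B"
    using orth unit by (intro pairwise_orthogonal_independent) force+
  then have span: "span B = UNIV"
    using card by (metis dim_UNIV independent_card_le_dim card_ge_dim_independent subset_UNIV
        order_refl top.extremum_uniqueI)
  have expand: "(\<Sum>e\<in>B. (b \<bullet> e) *\<^sub>R e) = b" for b
  proof -
    have "orthogonal (b - (\<Sum>e\<in>B. (b \<bullet> e / (e \<bullet> e)) *\<^sub>R e)) b'" for b'
      using Gram_Schmidt_step[OF orth, of b' b] span by (simp add: orthogonal_commute inner_commute[of b])
    then have "b - (\<Sum>e\<in>B. (b \<bullet> e / (e \<bullet> e)) *\<^sub>R e) = 0"
      using orthogonal_self by blast
    moreover have "(\<Sum>e\<in>B. (b \<bullet> e / (e \<bullet> e)) *\<^sub>R e) = (\<Sum>e\<in>B. (b \<bullet> e) *\<^sub>R e)"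
      using unit by (intro sum.cong) (auto simp: norm_eq_1)
    ultimately show ?thesis by simp
  qed
  have l1: "linear (\<lambda>x. \<beta> x y)" and l2: "linear (\<beta> x)" for x y
    using bil by (auto simp: bilinear_def)
  have "(\<Sum>e\<in>B. \<beta> e e) = (\<Sum>e\<in>B. \<beta> (\<Sum>b\<in>Basis. (e \<bullet> b) *\<^sub>R b) e)"
    by (simp add: euclidean_representation)
  also have "\<dots> = (\<Sum>e\<in>B. \<Sum>b\<in>Basis. \<beta> b ((b \<bullet> e) *\<^sub>R e))"
    by (simp add: linear_sum[OF l1] linear_cmul[OF l1] linear_cmul[OF l2] inner_commute)
  also have "\<dots> = (\<Sum>b\<in>Basis. \<beta> b (\<Sum>e\<in>B. (b \<bullet> e) *\<^sub>R e))"
    by (subst sum.swap) (simp add: linear_sum[OF l2])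
  also have "\<dots> = (\<Sum>b\<in>Basis. \<beta> b b)"
    by (simp add: expand)
  finally show ?thesis .
qed

definition symmetric_bilinear :: "('a::euclidean_space \<Rightarrow> 'a \<Rightarrow> 'b::euclidean_space) \<Rightarrow> bool" where
  "symmetric_bilinear \<beta> \<longleftrightarrow> bilinear \<beta> \<and> (\<forall>x y. \<beta> x y = \<beta> y x)"

text \<open>The operator \<open>x \<mapsto> T x\<close> with \<open>T x \<bullet> y = B x y\<close>, for a real bilinear form \<open>B\<close>.\<close>

definition operator_of_form :: "('a::euclidean_space \<Rightarrow> 'a \<Rightarrow> real) \<Rightarrow> 'a \<Rightarrow> 'a" where
  "operator_of_form B x = (\<Sum>e\<in>Basis. B x e *\<^sub>R e)"

lemma operator_of_form_inner:
  assumes "bilinear B"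
  shows "operator_of_form B x \<bullet> y = B x y"
proof -
  have lin: "linear (B x)"
    using assms by (simp add: bilinear_def)
  have "B x y = B x (\<Sum>e\<in>Basis. (y \<bullet> e) *\<^sub>R e)"
    by (simp add: euclidean_representation)
  also have "\<dots> = (\<Sum>e\<in>Basis. (y \<bullet> e) * B x e)"
    by (simp add: linear_sum[OF lin] linear_cmul[OF lin])
  also have "\<dots> = operator_of_form B x \<bullet> y"
    by (simp add: operator_of_form_def inner_sum_left inner_commute[of y] mult.commute)
  finally show ?thesis by simp
qed

lemma operator_of_form_unique:
  assumes "bilinear B" "\<And>x y. T x \<bullet> y = B x y"
  shows "T = operator_of_form B"
  using assms by (intro ext) (metis operator_of_form_inner vector_eq_rdot)

definition shape_operator ::
  "('a::euclidean_space \<Rightarrow> 'a \<Rightarrow> 'b::euclidean_space) \<Rightarrow> 'b \<Rightarrow> 'a \<Rightarrow> 'a" where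
  "shape_operator \<beta> \<xi> = operator_of_form (\<lambda>x y. \<beta> x y \<bullet> \<xi>)"

lemma shape_operator_inner:
  assumes "bilinear \<beta>"
  shows "shape_operator \<beta> \<xi> x \<bullet> y = \<beta> x y \<bullet> \<xi>"
proof -
  have "bilinear (\<lambda>x y. \<beta> x y \<bullet> \<xi>)"
    using assms unfolding bilinear_def linear_iff by (simp add: inner_add_left)
  then show ?thesis
    by (simp add: shape_operator_def operator_of_form_inner)
qed

definition mean_curvature_vector ::
  "('a::euclidean_space \<Rightarrow> 'a \<Rightarrow> 'b::euclidean_space) \<Rightarrow> 'b" where
  "mean_curvature_vector \<beta> = (1 / real DIM('a)) *\<^sub>R (\<Sum>e\<in>Basis. \<beta> e e)"

definition mean_curvature ::
  "('a::euclidean_space \<Rightarrow> 'a \<Rightarrow> 'b::euclidean_space) \<Rightarrow> real" where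
  "mean_curvature \<beta> = norm (mean_curvature_vector \<beta>)"

definition umbilical :: "('a::euclidean_space \<Rightarrow> 'a \<Rightarrow> 'b::euclidean_space) \<Rightarrow> bool" where
  "umbilical \<beta> \<longleftrightarrow> (\<forall>x y. \<beta> x y = (x \<bullet> y) *\<^sub>R mean_curvature_vector \<beta>)"

definition formal_curvature ::
  "real \<Rightarrow> ('a::euclidean_space \<Rightarrow> 'a \<Rightarrow> 'b::euclidean_space) \<Rightarrow> 'a \<Rightarrow> 'a \<Rightarrow> 'a \<Rightarrow> 'a \<Rightarrow> real" where
  "formal_curvature c \<beta> x1 x2 x3 x4 =
     c * ((x1 \<bullet> x3) * (x2 \<bullet> x4) - (x1 \<bullet> x4) * (x2 \<bullet> x3))
     + \<beta> x1 x3 \<bullet> \<beta> x2 x4 - \<beta> x1 x4 \<bullet> \<beta> x2 x3"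

definition formal_ricci ::
  "real \<Rightarrow> ('a::euclidean_space \<Rightarrow> 'a \<Rightarrow> 'b::euclidean_space) \<Rightarrow> 'a \<Rightarrow> 'a \<Rightarrow> real" where
  "formal_ricci c \<beta> x y = (\<Sum>e\<in>Basis. formal_curvature c \<beta> e x e y)"

definition ricci_operator ::
  "real \<Rightarrow> ('a::euclidean_space \<Rightarrow> 'a \<Rightarrow> 'b::euclidean_space) \<Rightarrow> 'a \<Rightarrow> 'a" where
  "ricci_operator c \<beta> =
     operator_of_form (\<lambda>x y. 1 / (real DIM('a) - 1) * formal_ricci c \<beta> x y)"

lemma ricci_operator_inner:
  assumes "bilinear \<beta>"
  shows "ricci_operator c (\<beta> :: 'a::euclidean_space \<Rightarrow> 'a \<Rightarrow> 'b::euclidean_space) x \<bullet> y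
    = 1 / (real DIM('a) - 1) * formal_ricci c \<beta> x y"
proof -
  have "bilinear (\<lambda>x y. formal_curvature c \<beta> e x e y)" for e
    using assms unfolding bilinear_def linear_iff formal_curvature_def
    by (simp add: inner_add_left inner_add_right algebra_simps)
  then have "bilinear (\<lambda>x y. formal_ricci c \<beta> x y)"
    unfolding bilinear_def linear_iff formal_ricci_def
    by (simp add: sum.distrib sum_distrib_left)
  then have "bilinear (\<lambda>x y. 1 / (real DIM('a) - 1) * formal_ricci c \<beta> x y)"
    unfolding bilinear_def linear_iff by (simp add: add_divide_distrib)
  then show ?thesis
    by (simp add: ricci_operator_def operator_of_form_inner)
qed

text \<open>
  The eigenvalues in increasing order, each repeated according to the dimension of its eigenspace.
  The spectral theorem gives this list length \<open>DIM('a)\<close> when \<open>T\<close> is self-adjoint.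
\<close>

definition eigenspace :: "('a::euclidean_space \<Rightarrow> 'a) \<Rightarrow> real \<Rightarrow> 'a set" where
  "eigenspace T \<mu> = {v. T v = \<mu> *\<^sub>R v}"

definition eigenvalues :: "('a::euclidean_space \<Rightarrow> 'a) \<Rightarrow> real set" where
  "eigenvalues T = {\<mu>. \<exists>v. v \<noteq> 0 \<and> T v = \<mu> *\<^sub>R v}"

definition eigenvalue_list :: "('a::euclidean_space \<Rightarrow> 'a) \<Rightarrow> real list" where
  "eigenvalue_list T =
     concat (map (\<lambda>\<mu>. replicate (dim (eigenspace T \<mu>)) \<mu>) (sorted_list_of_set (eigenvalues T)))"

lemma finite_eigenvalues_self_adjoint:
  fixes T :: "'a::euclidean_space \<Rightarrow> 'a"
  assumes sa: "\<And>x y. T x \<bullet> y = x \<bullet> T y"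
  shows "finite (eigenvalues T)"
proof -
  obtain v where v: "\<And>\<mu>. \<mu> \<in> eigenvalues T \<Longrightarrow> v \<mu> \<noteq> 0 \<and> T (v \<mu>) = \<mu> *\<^sub>R v \<mu>"
    unfolding eigenvalues_def by atomize_elim (intro choice allI, blast)
  have orth: "v \<mu> \<bullet> v \<nu> = 0" if "\<mu> \<in> eigenvalues T" "\<nu> \<in> eigenvalues T" "\<mu> \<noteq> \<nu>" for \<mu> \<nu>
    using sa[of "v \<mu>" "v \<nu>"] v[OF that(1)] v[OF that(2)] that(3) by simp
  have inj: "inj_on v (eigenvalues T)"
    by (rule inj_onI) (metis orth v inner_eq_zero_iff)
  have "pairwise orthogonal (v ` eigenvalues T)"
    unfolding pairwise_def orthogonal_def using orth by blast
  moreover have "0 \<notin> v ` eigenvalues T"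
    using v by force
  ultimately have "finite (v ` eigenvalues T)"
    using pairwise_orthogonal_independent independent_imp_finite by blast
  then show ?thesis
    using inj finite_imageD by blast
qed

definition ricci_eigenvalue ::
  "real \<Rightarrow> ('a::euclidean_space \<Rightarrow> 'a \<Rightarrow> 'b::euclidean_space) \<Rightarrow> nat \<Rightarrow> real" where
  "ricci_eigenvalue c \<beta> i = eigenvalue_list (ricci_operator c \<beta>) ! (i - 1)"

definition partial_scalar_curvature ::
  "real \<Rightarrow> ('a::euclidean_space \<Rightarrow> 'a \<Rightarrow> 'b::euclidean_space) \<Rightarrow> nat \<Rightarrow> real" where
  "partial_scalar_curvature c \<beta> k = 1 / real k * (\<Sum>i=1..k. ricci_eigenvalue c \<beta> i)"

definition scalar_curvature ::
  "real \<Rightarrow> ('a::euclidean_space \<Rightarrow> 'a \<Rightarrow> 'b::euclidean_space) \<Rightarrow> real" where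
  "scalar_curvature c \<beta> = partial_scalar_curvature c \<beta> DIM('a)"

definition commutator :: "('a::euclidean_space \<Rightarrow> 'a) \<Rightarrow> ('a \<Rightarrow> 'a) \<Rightarrow> 'a \<Rightarrow> 'a" where
  "commutator A B x = A (B x) - B (A x)"

definition normal_scalar_curvature ::
  "('a::euclidean_space \<Rightarrow> 'a \<Rightarrow> 'b::euclidean_space) \<Rightarrow> real" where
  "normal_scalar_curvature \<beta> =
     1 / (real DIM('a) * (real DIM('a) - 1)) *
     sqrt (\<Sum>e\<in>Basis. \<Sum>f\<in>Basis. \<Sum>\<xi>\<in>Basis. \<Sum>\<eta>\<in>Basis.
       (commutator (shape_operator \<beta> \<xi>) (shape_operator \<beta> \<eta>) e \<bullet> f)\<^sup>2)"

end

theory Submission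
  imports Defs
begin

text \<open>
  With \<open>\<phi>\<close> the traceless part of \<open>\<beta>\<close>, one has \<open>\<rho> = c + H\<^sup>2 - |\<phi>|\<^sup>2 / (n (n - 1))\<close>, and \<open>\<rho>\<^sub>k \<le> \<rho>\<close>
  with equality for some \<open>k < n\<close> only if the Ricci operator is a multiple of the identity. So
  everything rests on the DDVV inequality \<open>\<Sum> |[A\<^sub>a, A\<^sub>b]|\<^sup>2 \<le> (\<Sum> |A\<^sub>a|\<^sup>2)\<^sup>2\<close> for the shape operators of
  \<open>\<phi>\<close>, and on the fact that, for \<open>n \<ge> 3\<close>, equality with \<open>\<phi> \<noteq> 0\<close> forces a common kernel vector: on it
  the Ricci operator takes the value \<open>c + H\<^sup>2\<close>, hence everywhere, and then the trace gives \<open>\<phi> = 0\<close>.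

  For DDVV, rotate the normal basis so that the \<open>A\<^sub>a\<close> are pairwise orthogonal, \<open>A\<^sub>a = sqrt (x\<^sub>a) U\<^sub>a\<close>, and put
  \<open>c\<^sub>a\<^sub>b = |[U\<^sub>a, U\<^sub>b]|\<^sup>2\<close>. If \<open>\<Sum>\<^bsub>b\<in>S\<^esub> c\<^sub>a\<^sub>b \<le> |S| + 1\<close> whenever \<open>a \<notin> S\<close>, then
  \<open>\<Sum> x\<^sub>a x\<^sub>b c\<^sub>a\<^sub>b \<le> (\<Sum> x\<^sub>a)\<^sup>2\<close> follows by peeling off the minimum of \<open>x\<close>. The bound on the rows
  is read in an eigenbasis of \<open>U\<^sub>a\<close>: the entries of the \<open>U\<^sub>b\<close> weight the edges of a complete graph, and the
  claim is that the largest Laplacian eigenvalue is at most the total weight plus one. Extremal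
  weights are supported on a star.
\<close>

subsection \<open>Orthonormal bases and the spectral theorem\<close>

text \<open>The clauses are the hypotheses of \<open>sum_orthonormal_basis\<close>, so every trace
  over \<open>Basis\<close> can be moved to such a set. Finiteness follows from the nonzero
  cardinality.\<close>

definition orthonormal_basis :: "'a::euclidean_space set \<Rightarrow> bool" where
  "orthonormal_basis E \<longleftrightarrow>
     card E = DIM('a) \<and> pairwise orthogonal E \<and> (\<forall>e\<in>E. norm e = 1)"

lemma orthonormal_basis_finite:
  fixes E :: "'a::euclidean_space set"
  assumes "orthonormal_basis E" shows "finite E"
  using assms DIM_positive[where 'a='a] unfolding orthonormal_basis_def
  by (metis card.infinite less_irrefl)

lemma orthonormal_basis_sum:
  fixes b :: "'a::euclidean_space \<Rightarrow> 'a \<Rightarrow> 'b::euclidean_space"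
  assumes "orthonormal_basis E" "bilinear b"
  shows "(\<Sum>e\<in>E. b e e) = (\<Sum>e\<in>Basis. b e e)"
  using assms by (intro sum_orthonormal_basis) (auto simp: orthonormal_basis_def)

lemma orthonormal_basis_inner:
  assumes "orthonormal_basis E" "e \<in> E" "f \<in> E"
  shows "e \<bullet> f = (if e = f then 1 else 0)"
  using assms by (auto simp: orthonormal_basis_def pairwise_def orthogonal_def norm_eq_1)

text \<open>Both sides are traces of the form sending a, b to
  \<open>(x \<bullet> a) * (y \<bullet> b)\<close>, taken over two orthonormal bases.\<close>

lemma orthonormal_basis_Parseval:
  assumes "orthonormal_basis E"
  shows "x \<bullet> y = (\<Sum>e\<in>E. (x \<bullet> e) * (y \<bullet> e))"
proof -
  have "bilinear (\<lambda>a b. (x \<bullet> a) * (y \<bullet> b))"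
    unfolding bilinear_def linear_iff by (simp add: inner_add_right algebra_simps)
  from orthonormal_basis_sum[OF assms this] show ?thesis
    by (simp add: euclidean_inner[of x y])
qed

lemma orthonormal_basis_expansion:
  assumes "orthonormal_basis E"
  shows "x = (\<Sum>e\<in>E. (x \<bullet> e) *\<^sub>R e)"
proof -
  have "x \<bullet> y = (\<Sum>e\<in>E. (x \<bullet> e) *\<^sub>R e) \<bullet> y" for y
    by (simp add: orthonormal_basis_Parseval[OF assms, of x y] inner_sum_left inner_commute[of y])
  then show ?thesis by (metis vector_eq_rdot)
qed

lemma orthonormal_basis_independent:
  assumes "orthonormal_basis E" shows "independent E"
  using assms by (intro pairwise_orthogonal_independent) (force simp: orthonormal_basis_def)+

text \<open>The first-order condition at a minimum, in the form needed to vary the Rayleigh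
  quotient.\<close>

lemma nonneg_quadratic_imp_linear_zero:
  fixes b c :: real
  assumes "\<And>t. 0 \<le> 2 * t * b + t\<^sup>2 * c"
  shows "b = 0"
proof (rule ccontr)
  assume "b \<noteq> 0"
  \<comment> \<open>Since \<open>d\<close> is positive and larger than \<open>c\<close>, the
    quadratic is negative at t = -b/d.\<close>
  define d where "d = \<bar>c\<bar> + 1"
  have d: "d > 0" "c < d" by (auto simp: d_def)
  have "0 \<le> 2 * (- b / d) * b + (- b / d)\<^sup>2 * c" by (rule assms)
  also have "\<dots> = b\<^sup>2 / d\<^sup>2 * (c - 2 * d)"
    using d by (simp add: field_simps power2_eq_square)
  also have "\<dots> < 0"
    using d \<open>b \<noteq> 0\<close> by (intro mult_pos_neg) auto
  finally show False by simp
qed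

text \<open>The vector \<open>e\<close> maximizes the Rayleigh quotient on the unit sphere of
  \<open>V\<close>. The first variation makes \<open>l *\<^sub>R e - T e\<close> orthogonal to
  \<open>V\<close>; by invariance it also lies in \<open>V\<close>, so it is zero.\<close>

lemma self_adjoint_eigenvector_subspace:
  fixes T :: "'a::euclidean_space \<Rightarrow> 'a"
  assumes lin: "linear T" and sa: "\<And>x y. T x \<bullet> y = x \<bullet> T y"
    and V: "subspace V" "T ` V \<subseteq> V" "dim V > 0"
  obtains e where "e \<in> V" "norm e = 1" "T e = (T e \<bullet> e) *\<^sub>R e"
proof -
  obtain v where v: "v \<in> V" "v \<noteq> 0"
    using V(3) dim_eq_0[of V] that by fastforce
  have "compact (sphere 0 1 \<inter> V)"
    by (intro compact_Int_closed compact_sphere closed_subspace V)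
  moreover have "(1 / norm v) *\<^sub>R v \<in> sphere 0 1 \<inter> V"
    using v V by (simp add: subspace_scale)
  moreover have "continuous_on (sphere 0 1 \<inter> V) (\<lambda>x. T x \<bullet> x)"
    using linear_continuous_on[of T] lin
    by (intro continuous_on_inner continuous_on_id) (simp add: linear_conv_bounded_linear)
  ultimately obtain e where e: "e \<in> sphere 0 1 \<inter> V"
    and max: "\<And>x. x \<in> sphere 0 1 \<inter> V \<Longrightarrow> T x \<bullet> x \<le> T e \<bullet> e"
    using continuous_attains_sup[of "sphere 0 1 \<inter> V" "\<lambda>x. T x \<bullet> x"] by blast
  define l where "l = T e \<bullet> e"
  have ee: "e \<bullet> e = 1" "e \<in> V" using e by (auto simp: norm_eq_1)
  have pos: "0 \<le> l * (x \<bullet> x) - T x \<bullet> x" if "x \<in> V" for x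
  proof (cases "x = 0")
    case False
    then have "T ((1 / norm x) *\<^sub>R x) \<bullet> ((1 / norm x) *\<^sub>R x) \<le> l"
      unfolding l_def using that V by (intro max) (simp add: subspace_scale)
    then have "(T x \<bullet> x) / (norm x)\<^sup>2 \<le> l"
      by (simp add: linear_cmul[OF lin] power2_eq_square)
    then show ?thesis
      using False by (simp add: field_simps power2_norm_eq_inner)
  qed (simp add: linear_0[OF lin])
  \<comment> \<open>The form in \<open>pos\<close> vanishes at \<open>e\<close>, so along the line
    \<open>e + t *\<^sub>R y\<close> it has no constant term.\<close>
  have "l * (e \<bullet> y) - T e \<bullet> y = 0" if y: "y \<in> V" for y
  proof (rule nonneg_quadratic_imp_linear_zero)
    fix t :: real
    have "e + t *\<^sub>R y \<in> V" using ee y V by (simp add: subspace_add subspace_scale)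
    from pos[OF this] have "0 \<le> l * ((e + t *\<^sub>R y) \<bullet> (e + t *\<^sub>R y)) - T (e + t *\<^sub>R y) \<bullet> (e + t *\<^sub>R y)" .
    also have "\<dots> = 2 * t * (l * (e \<bullet> y) - T e \<bullet> y) + t\<^sup>2 * (l * (y \<bullet> y) - T y \<bullet> y)"
      using ee sa[of y e] l_def inner_commute[of y e] inner_commute[of y "T e"]
      by (simp add: linear_add[OF lin] linear_cmul[OF lin] inner_add_left inner_add_right
          power2_eq_square algebra_simps)
    finally show "0 \<le> 2 * t * (l * (e \<bullet> y) - T e \<bullet> y) + t\<^sup>2 * (l * (y \<bullet> y) - T y \<bullet> y)" .
  qed
  then have "(l *\<^sub>R e - T e) \<bullet> y = 0" if "y \<in> V" for y
    using that by (simp add: inner_diff_left)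
  moreover have "l *\<^sub>R e - T e \<in> V"
    using ee V by (intro subspace_diff subspace_scale) auto
  ultimately have "(l *\<^sub>R e - T e) \<bullet> (l *\<^sub>R e - T e) = 0" by blast
  with that[of e] ee show thesis by (simp add: l_def norm_eq_1)
qed

text \<open>Induction on the dimension: self-adjointness makes the orthogonal complement of an
  eigenvector in \<open>V\<close> invariant again.\<close>

lemma self_adjoint_diagonalizable_subspace:
  fixes T :: "'a::euclidean_space \<Rightarrow> 'a"
  assumes lin: "linear T" and sa: "\<And>x y. T x \<bullet> y = x \<bullet> T y"
    and "subspace V" "T ` V \<subseteq> V"
  shows "\<exists>E\<subseteq>V. finite E \<and> card E = dim V \<and> pairwise orthogonal E \<and>
           (\<forall>e\<in>E. norm e = 1 \<and> T e = (T e \<bullet> e) *\<^sub>R e)"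
  using assms(3,4)
proof (induction "dim V" arbitrary: V)
  case 0
  then show ?case by (intro exI[of _ "{}"]) simp
next
  case (Suc d)
  obtain e where e: "e \<in> V" "norm e = 1" "T e = (T e \<bullet> e) *\<^sub>R e"
    using self_adjoint_eigenvector_subspace[OF lin sa Suc(3,4)] Suc(2) by auto
  define V' where "V' = {y \<in> V. \<forall>x\<in>span {e}. orthogonal x y}"
  have V': "V' = {y \<in> V. e \<bullet> y = 0}"
    by (auto simp: V'_def span_singleton orthogonal_def intro: exI[of _ 1])
  have "dim V' + dim (span {e}) = dim V"
    unfolding V'_def using e Suc(3) by (intro dim_subspace_orthogonal_to_vectors)
      (auto simp: span_minimal)
  moreover have "dim (span {e}) = 1"
    using e(2) by (subst dim_span) (metis dim_singleton norm_zero zero_neq_one)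
  ultimately have "d = dim V'" using Suc(2) by simp
  moreover have "subspace V'"
    using Suc(3) unfolding V' subspace_def by (simp add: inner_add_right)
  moreover have "T ` V' \<subseteq> V'"
    using Suc(4) e(3) unfolding V' by (auto simp flip: sa) (metis inner_scaleR_left mult_zero_right)
  ultimately obtain E where E: "E \<subseteq> V'" "finite E" "card E = dim V'" "pairwise orthogonal E"
    "\<forall>e\<in>E. norm e = 1 \<and> T e = (T e \<bullet> e) *\<^sub>R e"
    using Suc(1) by metis
  have "e \<notin> E" using E(1) e(2) by (auto simp: V' norm_eq_1)
  moreover have "pairwise orthogonal (insert e E)"
    using E(1,4) by (auto simp: pairwise_insert orthogonal_def V' inner_commute)
  ultimately show ?case
    using E e \<open>d = dim V'\<close> Suc(2) by (intro exI[of _ "insert e E"]) (auto simp: V')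
qed

theorem self_adjoint_diagonalizable:
  fixes T :: "'a::euclidean_space \<Rightarrow> 'a"
  assumes "linear T" "\<And>x y. T x \<bullet> y = x \<bullet> T y"
  obtains E where "orthonormal_basis E" "\<And>e. e \<in> E \<Longrightarrow> T e = (T e \<bullet> e) *\<^sub>R e"
  using self_adjoint_diagonalizable_subspace[OF assms, of UNIV] that
  by (auto simp: orthonormal_basis_def)

section \<open>Eigenvalues counted with multiplicity\<close>

lemma eigenspace_eq_span:
  assumes lin: "linear T" and sa: "\<And>x y. T x \<bullet> y = x \<bullet> T y"
    and E: "orthonormal_basis E" "\<And>e. e \<in> E \<Longrightarrow> T e = \<mu> e *\<^sub>R e"
  shows "eigenspace T l = span {e \<in> E. \<mu> e = l}"
proof
  show "span {e \<in> E. \<mu> e = l} \<subseteq> eigenspace T l"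
    using E(2) lin by (intro span_minimal)
      (auto simp: eigenspace_def subspace_def linear_0 linear_add linear_cmul scaleR_add_right)
next
  show "eigenspace T l \<subseteq> span {e \<in> E. \<mu> e = l}"
  proof
    fix v assume v: "v \<in> eigenspace T l"
    have "(v \<bullet> e) *\<^sub>R e \<in> span {e \<in> E. \<mu> e = l}" if e: "e \<in> E" for e
    proof (cases "\<mu> e = l")
      case True
      then show ?thesis using e by (simp add: span_base span_mul)
    next
      case False
      \<comment> \<open>Self-adjointness kills the coordinates of \<open>v\<close> along
        eigenvectors for other eigenvalues.\<close>
      have "l * (v \<bullet> e) = \<mu> e * (v \<bullet> e)"
        using sa[of v e] v E(2)[OF e] by (simp add: eigenspace_def)
      with False show ?thesis by (simp add: span_zero)
    qed
    then show "v \<in> span {e \<in> E. \<mu> e = l}"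
      by (subst orthonormal_basis_expansion[OF E(1)]) (intro span_sum)
  qed
qed

lemma eigenvalues_eq_image:
  assumes lin: "linear T" and sa: "\<And>x y. T x \<bullet> y = x \<bullet> T y"
    and E: "orthonormal_basis E" "\<And>e. e \<in> E \<Longrightarrow> T e = \<mu> e *\<^sub>R e"
  shows "eigenvalues T = \<mu> ` E"
proof
  show "\<mu> ` E \<subseteq> eigenvalues T"
  proof
    fix l assume "l \<in> \<mu> ` E"
    then obtain e where "e \<in> E" "l = \<mu> e" by blast
    then show "l \<in> eigenvalues T"
      using E orthonormal_basis_inner[OF E(1), of e e]
      by (auto simp: eigenvalues_def intro!: exI[of _ e])
  qed
  show "eigenvalues T \<subseteq> \<mu> ` E"
  proof
    fix l assume "l \<in> eigenvalues T"
    then obtain v where v: "v \<noteq> 0" "v \<in> eigenspace T l"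
      by (auto simp: eigenvalues_def eigenspace_def)
    then have "{e \<in> E. \<mu> e = l} \<noteq> {}"
      using eigenspace_eq_span[OF assms, of l] by (auto simp del: Collect_empty_eq)
    then show "l \<in> \<mu> ` E" by auto
  qed
qed

text \<open>This ties the multiplicities, given as dimensions of eigenspaces, to a diagonalization:
  the members of \<open>E\<close> with value \<open>l\<close> are a basis of the eigenspace of
  \<open>l\<close>. The order of the list is left to \<open>sorted_eigenvalue_list\<close>.\<close>

lemma mset_eigenvalue_list:
  assumes lin: "linear T" and sa: "\<And>x y. T x \<bullet> y = x \<bullet> T y"
    and E: "orthonormal_basis E" "\<And>e. e \<in> E \<Longrightarrow> T e = \<mu> e *\<^sub>R e"
  shows "mset (eigenvalue_list T) = image_mset \<mu> (mset_set E)"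
proof (rule multiset_eqI)
  fix l
  have fin: "finite E" by (rule orthonormal_basis_finite[OF E(1)])
  have dims: "dim (eigenspace T l) = card {e \<in> E. \<mu> e = l}" for l
  proof -
    have "independent {e \<in> E. \<mu> e = l}"
      by (rule independent_mono[OF orthonormal_basis_independent[OF E(1)]]) auto
    then show ?thesis
      by (simp add: eigenspace_eq_span[OF assms] dim_eq_card_independent)
  qed
  have ev: "set (sorted_list_of_set (eigenvalues T)) = \<mu> ` E"
    using fin by (simp add: eigenvalues_eq_image[OF assms])
  have *: "count (mset (concat (map (\<lambda>x. replicate (d x) x) xs))) l = (if l \<in> set xs then d l else 0)"
    if "distinct xs" for d and xs :: "real list"
    using that by (induction xs) auto
  have "count (mset (eigenvalue_list T)) l = (if l \<in> \<mu> ` E then card {e \<in> E. \<mu> e = l} else 0)"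
    unfolding eigenvalue_list_def by (subst *) (simp_all add: ev dims)
  also have "\<dots> = card {e \<in> E. \<mu> e = l}" by (auto simp: card_eq_0_iff)
  also have "\<dots> = count (image_mset \<mu> (mset_set E)) l"
    using fin by (simp add: count_image_mset Int_def vimage_def conj_commute)
  finally show "count (mset (eigenvalue_list T)) l = count (image_mset \<mu> (mset_set E)) l" .
qed

lemma sorted_eigenvalue_list: "sorted (eigenvalue_list T)"
proof -
  have "sorted (concat (map (\<lambda>x. replicate (d x) x) xs))" if "sorted xs" for d and xs :: "real list"
    using that by (induction xs) (auto simp: sorted_append)
  then show ?thesis by (simp add: eigenvalue_list_def)
qed

text \<open>All three facts are read off from an orthonormal eigenbasis; the last one recovers a
  scalar operator from a constant list.\<close>

lemma eigenvalue_list_trace: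
  fixes T :: "'a::euclidean_space \<Rightarrow> 'a"
  assumes lin: "linear T" and sa: "\<And>x y. T x \<bullet> y = x \<bullet> T y"
  shows "length (eigenvalue_list T) = DIM('a)"
    and "sum_list (eigenvalue_list T) = (\<Sum>e\<in>Basis. T e \<bullet> e)"
    and "set (eigenvalue_list T) \<subseteq> {l} \<Longrightarrow> T x = l *\<^sub>R x"
proof -
  obtain E where E: "orthonormal_basis E" "\<And>e. e \<in> E \<Longrightarrow> T e = (T e \<bullet> e) *\<^sub>R e"
    using self_adjoint_diagonalizable[OF assms] by blast
  have fin: "finite E" by (rule orthonormal_basis_finite[OF E(1)])
  note ms = mset_eigenvalue_list[OF assms E]
  show "length (eigenvalue_list T) = DIM('a)"
    using arg_cong[OF ms, of size] E(1) by (simp add: orthonormal_basis_def)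
  have "bilinear (\<lambda>x y. T x \<bullet> y)"
    using lin unfolding bilinear_def linear_iff by (simp add: inner_add_left inner_add_right)
  with orthonormal_basis_sum[OF E(1)] have "(\<Sum>e\<in>E. T e \<bullet> e) = (\<Sum>e\<in>Basis. T e \<bullet> e)" .
  then show "sum_list (eigenvalue_list T) = (\<Sum>e\<in>Basis. T e \<bullet> e)"
    using arg_cong[OF ms, of sum_mset] by (simp add: sum_mset_sum_list sum_unfold_sum_mset)
  assume l: "set (eigenvalue_list T) \<subseteq> {l}"
  have "T e = l *\<^sub>R e" if "e \<in> E" for e
    using arg_cong[OF ms, of set_mset] l fin that E(2)[OF that] by auto
  then have "T (\<Sum>e\<in>E. (x \<bullet> e) *\<^sub>R e) = l *\<^sub>R (\<Sum>e\<in>E. (x \<bullet> e) *\<^sub>R e)"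
    by (simp add: linear_sum[OF lin] linear_cmul[OF lin] scaleR_sum_right mult.commute)
  then show "T x = l *\<^sub>R x" by (simp flip: orthonormal_basis_expansion[OF E(1)])
qed

subsection \<open>The Laplacian of a weighted graph\<close>

text \<open>Bessel's inequality for real functions on \<open>I\<close>: the squared distance of
  \<open>p\<close> from its projection to the span of the \<open>v b\<close> is expanded.\<close>

lemma Bessel_coordinates:
  fixes v :: "'b \<Rightarrow> 'i \<Rightarrow> real"
  assumes "finite S"
    and orth: "\<And>b b'. b \<in> S \<Longrightarrow> b' \<in> S \<Longrightarrow> (\<Sum>i\<in>I. v b i * v b' i) = (if b = b' then 1 else 0)"
  shows "(\<Sum>b\<in>S. (\<Sum>i\<in>I. v b i * p i)\<^sup>2) \<le> (\<Sum>i\<in>I. (p i)\<^sup>2)"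
proof -
  define \<alpha> where "\<alpha> b = (\<Sum>i\<in>I. v b i * p i)" for b
  have "0 \<le> (\<Sum>i\<in>I. (p i - (\<Sum>b\<in>S. \<alpha> b * v b i))\<^sup>2)"
    by (intro sum_nonneg) auto
  also have "\<dots> = (\<Sum>i\<in>I. (p i)\<^sup>2) - 2 * (\<Sum>i\<in>I. \<Sum>b\<in>S. \<alpha> b * (v b i * p i))
      + (\<Sum>i\<in>I. \<Sum>b\<in>S. \<Sum>b'\<in>S. \<alpha> b * \<alpha> b' * (v b i * v b' i))"
    by (simp add: power2_eq_square left_diff_distrib right_diff_distrib sum.distrib sum_subtractf sum_negf
        sum_product sum_distrib_left sum_distrib_right mult_ac)
  also have "(\<Sum>i\<in>I. \<Sum>b\<in>S. \<alpha> b * (v b i * p i)) = (\<Sum>b\<in>S. (\<alpha> b)\<^sup>2)"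
    by (subst sum.swap) (simp add: power2_eq_square \<alpha>_def flip: sum_distrib_left)
  also have "(\<Sum>i\<in>I. \<Sum>b\<in>S. \<Sum>b'\<in>S. \<alpha> b * \<alpha> b' * (v b i * v b' i))
      = (\<Sum>b\<in>S. \<Sum>b'\<in>S. \<alpha> b * \<alpha> b' * (\<Sum>i\<in>I. v b i * v b' i))"
    by (subst sum.swap, intro sum.cong refl, subst sum.swap) (simp add: sum_distrib_left)
  also have "\<dots> = (\<Sum>b\<in>S. \<Sum>b'\<in>S. \<alpha> b * \<alpha> b' * (if b = b' then 1 else 0))"
    by (intro sum.cong refl) (simp add: orth)
  also have "\<dots> = (\<Sum>b\<in>S. (\<alpha> b)\<^sup>2)"
    using \<open>finite S\<close> by (simp add: if_distrib power2_eq_square cong: if_cong)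
  finally show ?thesis by (simp add: \<alpha>_def)
qed

text \<open>The rows and columns of \<open>i\<close> and \<open>j\<close> carry each row sum twice.
  Their overlap, the two entries joining \<open>i\<close> and \<open>j\<close>, has to be
  subtracted; the diagonal is zero.\<close>

lemma sum_split_two_rows_columns:
  fixes w :: "'i \<Rightarrow> 'i \<Rightarrow> real"
  assumes "finite E" and nonneg: "\<And>i j. 0 \<le> w i j" and sym: "\<And>i j. w i j = w j i"
    and diag: "\<And>i. w i i = 0" and ij: "i \<in> E" "j \<in> E" "i \<noteq> j"
  shows "2 * (\<Sum>l\<in>E. w i l) + 2 * (\<Sum>l\<in>E. w j l) - 2 * w i j
           + (\<Sum>k\<in>E-{i,j}. \<Sum>l\<in>E-{i,j}. w k l) = (\<Sum>k\<in>E. \<Sum>l\<in>E. w k l)"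
proof -
  have split: "(\<Sum>l\<in>E. f l) = f i + f j + (\<Sum>l\<in>E-{i,j}. f l)" for f :: "'i \<Rightarrow> real"
  proof -
    have "E = insert i (insert j (E - {i,j}))" using ij by auto
    then have "sum f E = sum f (insert i (insert j (E - {i,j})))" by simp
    also have "\<dots> = f i + f j + (\<Sum>l\<in>E-{i,j}. f l)"
      using \<open>finite E\<close> ij by (subst sum.insert) auto
    finally show ?thesis .
  qed
  have "(\<Sum>k\<in>E-{i,j}. \<Sum>l\<in>E. w k l) = (\<Sum>l\<in>E-{i,j}. w i l) + (\<Sum>l\<in>E-{i,j}. w j l)
      + (\<Sum>k\<in>E-{i,j}. \<Sum>l\<in>E-{i,j}. w k l)"
    by (simp add: split[of "w _"] sum.distrib sym[of _ i] sym[of _ j])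
  then show ?thesis
    using split[of "\<lambda>k. \<Sum>l\<in>E. w k l"] split[of "w i"] split[of "w j"] diag sym[of j i] by simp
qed

text \<open>Lagrange's identity, that is, the variance of \<open>y\<close> for the weights
  \<open>a\<close> without division by the total weight.\<close>

lemma sum_times_sum_squares_diff:
  fixes a y :: "'i \<Rightarrow> real"
  shows "(\<Sum>j\<in>E. a j) * (\<Sum>j\<in>E. a j * (y j)\<^sup>2) - (\<Sum>j\<in>E. a j * y j)\<^sup>2
    = (\<Sum>j\<in>E. \<Sum>l\<in>E. a j * a l * (y j - y l)\<^sup>2) / 2"
proof -
  have "(\<Sum>j\<in>E. \<Sum>l\<in>E. a j * a l * (y j - y l)\<^sup>2)
     = (\<Sum>j\<in>E. \<Sum>l\<in>E. a l * (a j * (y j)\<^sup>2)) + (\<Sum>j\<in>E. \<Sum>l\<in>E. a j * (a l * (y l)\<^sup>2))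
        - 2 * (\<Sum>j\<in>E. \<Sum>l\<in>E. (a j * y j) * (a l * y l))"
    by (simp add: sum_distrib_left power2_diff sum.distrib sum_subtractf algebra_simps power2_eq_square)
  also have "\<dots> = 2 * ((\<Sum>j\<in>E. a j) * (\<Sum>j\<in>E. a j * (y j)\<^sup>2) - (\<Sum>j\<in>E. a j * y j)\<^sup>2)"
    by (subst sum.swap) (simp add: sum_product power2_eq_square)
  finally show ?thesis by simp
qed

text \<open>The properties of the entries of \<open>k\<close> orthonormal symmetric matrices that
  the bound needs. Sums run over ordered pairs, so \<open>energy\<close> is the quadratic form of
  the Laplacian with edge weights 2 \<open>w\<close>, whose total over unordered edges is at most
  \<open>k\<close>.\<close>

locale small_weighted_graph =
  fixes E :: "'i set" and w :: "'i \<Rightarrow> 'i \<Rightarrow> real" and k :: real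
  assumes finite_E: "finite E"
    and w_nonneg: "\<And>i j. 0 \<le> w i j" and w_sym: "\<And>i j. w i j = w j i"
    and w_diag: "\<And>i. w i i = 0"
    and w_le: "\<And>i j. i \<in> E \<Longrightarrow> j \<in> E \<Longrightarrow> w i j \<le> 1 / 2"
    and w_total: "(\<Sum>i\<in>E. \<Sum>j\<in>E. w i j) \<le> k"
begin

definition deg :: "'i \<Rightarrow> real" where "deg i = (\<Sum>j\<in>E. w i j)"

definition lap :: "('i \<Rightarrow> real) \<Rightarrow> 'i \<Rightarrow> real" where
  "lap \<eta> i = (\<Sum>j\<in>E. w i j * (\<eta> i - \<eta> j))"

definition energy :: "('i \<Rightarrow> real) \<Rightarrow> real" where
  "energy \<eta> = (\<Sum>i\<in>E. \<Sum>j\<in>E. w i j * (\<eta> i - \<eta> j)\<^sup>2)"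

lemma energy_eq_lap: "energy \<eta> = 2 * (\<Sum>i\<in>E. \<eta> i * lap \<eta> i)"
proof -
  have "energy \<eta> = (\<Sum>i\<in>E. \<Sum>j\<in>E. \<eta> i * (w i j * (\<eta> i - \<eta> j)))
      + (\<Sum>i\<in>E. \<Sum>j\<in>E. \<eta> j * (w i j * (\<eta> j - \<eta> i)))"
    unfolding energy_def sum.distrib[symmetric]
    by (intro sum.cong refl) (simp add: power2_eq_square algebra_simps)
  also have "(\<Sum>i\<in>E. \<Sum>j\<in>E. \<eta> j * (w i j * (\<eta> j - \<eta> i)))
      = (\<Sum>i\<in>E. \<Sum>j\<in>E. \<eta> i * (w i j * (\<eta> i - \<eta> j)))"
    by (subst sum.swap) (simp add: w_sym)
  finally show ?thesis by (simp add: lap_def sum_distrib_left)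
qed

lemma k_nonneg: "0 \<le> k"
  using w_total w_nonneg by (meson order_trans sum_nonneg)

text \<open>Source of the \<open>+ 1\<close>: in the count of
  \<open>sum_split_two_rows_columns\<close> the overlap \<open>2 * w i j\<close> is at most 1, and
  the total is at most \<open>k\<close>.\<close>

lemma deg_add_le:
  assumes "i \<in> E" "j \<in> E" "i \<noteq> j"
  shows "deg i + deg j + (\<Sum>u\<in>E-{i,j}. \<Sum>v\<in>E-{i,j}. w u v) / 2 \<le> (k + 1) / 2"
  using sum_split_two_rows_columns[of E w i j, OF finite_E w_nonneg w_sym w_diag assms] w_total
    w_le[OF assms(1,2)] unfolding deg_def by simp

text \<open>Each of the three sums is nonnegative. In the extremal case their vanishing says that \<open>\<eta>\<close> is an
  eigenvector of the Laplacian, that \<open>\<eta>\<close> is constant on the neighbours of any vertex, and that no edge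
  is disjoint from an edge on which \<open>\<eta>\<close> varies.\<close>

lemma energy_defect:
  "(k + 1) * ((k + 1) * (\<Sum>i\<in>E. (\<eta> i)\<^sup>2) - energy \<eta>)
   = (\<Sum>i\<in>E. ((k + 1) * \<eta> i - 2 * lap \<eta> i)\<^sup>2)
     + 2 * (\<Sum>i\<in>E. \<Sum>j\<in>E. \<Sum>l\<in>E. w i j * w i l * (\<eta> l - \<eta> j)\<^sup>2)
     + 2 * (\<Sum>i\<in>E. \<Sum>j\<in>E. ((k + 1) / 2 - deg i - deg j) * w i j * (\<eta> i - \<eta> j)\<^sup>2)"
proof -
  \<comment> \<open>The weighted variance of \<open>\<eta> i - \<eta> j\<close> over the neighbours
    \<open>j\<close> of \<open>i\<close>; the difference of two such values no longer involves
    \<open>\<eta> i\<close>.\<close>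
  have half: "(\<Sum>j\<in>E. \<Sum>l\<in>E. w i j * w i l * (\<eta> l - \<eta> j)\<^sup>2) / 2
      = deg i * (\<Sum>j\<in>E. w i j * (\<eta> i - \<eta> j)\<^sup>2) - (lap \<eta> i)\<^sup>2" for i
    using sum_times_sum_squares_diff[of "w i" E "\<lambda>j. \<eta> i - \<eta> j"]
    by (simp add: deg_def lap_def)
  have defect_i: "(\<Sum>j\<in>E. \<Sum>l\<in>E. w i j * w i l * (\<eta> l - \<eta> j)\<^sup>2)
      = 2 * (deg i * (\<Sum>j\<in>E. w i j * (\<eta> i - \<eta> j)\<^sup>2)) - 2 * (lap \<eta> i)\<^sup>2" for i
    using half[of i] by linarith
  have A: "(\<Sum>i\<in>E. \<Sum>j\<in>E. \<Sum>l\<in>E. w i j * w i l * (\<eta> l - \<eta> j)\<^sup>2)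
      = 2 * (\<Sum>i\<in>E. \<Sum>j\<in>E. deg i * (w i j * (\<eta> i - \<eta> j)\<^sup>2)) - 2 * (\<Sum>i\<in>E. (lap \<eta> i)\<^sup>2)"
    unfolding defect_i sum_subtractf by (simp add: sum_distrib_left)
  have "(\<Sum>i\<in>E. \<Sum>j\<in>E. deg j * (w i j * (\<eta> i - \<eta> j)\<^sup>2))
      = (\<Sum>i\<in>E. \<Sum>j\<in>E. deg i * (w i j * (\<eta> i - \<eta> j)\<^sup>2))"
    by (subst sum.swap, intro sum.cong refl) (simp add: w_sym power2_commute)
  then have B: "(\<Sum>i\<in>E. \<Sum>j\<in>E. ((k + 1) / 2 - deg i - deg j) * w i j * (\<eta> i - \<eta> j)\<^sup>2)
      = (k + 1) / 2 * energy \<eta> - 2 * (\<Sum>i\<in>E. \<Sum>j\<in>E. deg i * (w i j * (\<eta> i - \<eta> j)\<^sup>2))"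
    by (simp only: energy_def sum_subtractf left_diff_distrib mult.assoc
        sum_distrib_left[of "(k + 1) / 2"])
  have C: "(\<Sum>i\<in>E. ((k + 1) * \<eta> i - 2 * lap \<eta> i)\<^sup>2)
      = (k + 1)\<^sup>2 * (\<Sum>i\<in>E. (\<eta> i)\<^sup>2) - 2 * (k + 1) * energy \<eta> + 4 * (\<Sum>i\<in>E. (lap \<eta> i)\<^sup>2)"
    unfolding energy_eq_lap
    by (simp add: power2_diff sum.distrib sum_subtractf power_mult_distrib sum_distrib_left mult_ac)
  \<comment> \<open>The squares of \<open>lap\<close> cancel between \<open>A\<close> and
    \<open>C\<close>, the degree terms between \<open>A\<close> and \<open>B\<close>.\<close>
  show ?thesis unfolding A B C by (simp add: power2_eq_square algebra_simps)
qed

lemma defect_nonneg: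
  assumes "i \<in> E" "j \<in> E"
  shows "0 \<le> ((k + 1) / 2 - deg i - deg j) * w i j * (\<eta> i - \<eta> j)\<^sup>2"
proof (cases "i = j")
  case False
  have "0 \<le> (\<Sum>u\<in>E-{i,j}. \<Sum>v\<in>E-{i,j}. w u v)" by (intro sum_nonneg w_nonneg)
  then have "0 \<le> (k + 1) / 2 - deg i - deg j"
    using deg_add_le[OF assms False] by linarith
  then show ?thesis
    using w_nonneg by simp
qed simp

theorem energy_le: "energy \<eta> \<le> (k + 1) * (\<Sum>i\<in>E. (\<eta> i)\<^sup>2)"
proof -
  have "0 \<le> (k + 1) * ((k + 1) * (\<Sum>i\<in>E. (\<eta> i)\<^sup>2) - energy \<eta>)"
    unfolding energy_defect
    by (intro add_nonneg_nonneg mult_nonneg_nonneg sum_nonneg defect_nonneg w_nonneg) auto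
  then show ?thesis
    using k_nonneg by (simp add: zero_le_mult_iff)
qed

text \<open>Equality kills all three sums of \<open>energy_defect\<close>. Their vanishing forces
  the edges of nonzero weight into a star, isolates the zeros of \<open>\<eta>\<close> and makes the
  total weight attain its bound.\<close>

theorem energy_extremal:
  assumes eq: "energy \<eta> = (k + 1) * (\<Sum>i\<in>E. (\<eta> i)\<^sup>2)" and nz: "i0 \<in> E" "\<eta> i0 \<noteq> 0"
  obtains u where "u \<in> E" "\<And>i j. i \<in> E \<Longrightarrow> j \<in> E \<Longrightarrow> w i j \<noteq> 0 \<Longrightarrow> i = u \<or> j = u"
    "\<And>i j. i \<in> E \<Longrightarrow> j \<in> E \<Longrightarrow> \<eta> i = 0 \<Longrightarrow> w i j = 0"
    "(\<Sum>i\<in>E. \<Sum>j\<in>E. w i j) = k"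
proof -
  let ?P = "\<Sum>i\<in>E. ((k + 1) * \<eta> i - 2 * lap \<eta> i)\<^sup>2"
  let ?Q = "\<Sum>i\<in>E. \<Sum>j\<in>E. \<Sum>l\<in>E. w i j * w i l * (\<eta> l - \<eta> j)\<^sup>2"
  let ?R = "\<Sum>i\<in>E. \<Sum>j\<in>E. ((k + 1) / 2 - deg i - deg j) * w i j * (\<eta> i - \<eta> j)\<^sup>2"
  note extremal = that
  have nn: "0 \<le> ?P" "0 \<le> ?Q" "0 \<le> ?R"
    by (intro sum_nonneg mult_nonneg_nonneg defect_nonneg w_nonneg; simp)+
  have "?P + 2 * ?Q + 2 * ?R = 0"
    using energy_defect[of \<eta>] eq by simp
  with nn have z: "?P = 0" "?Q = 0" "?R = 0" by linarith+
  have P: "(k + 1) * \<eta> i = 2 * lap \<eta> i" if "i \<in> E" for i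
    using z(1) that finite_E by (subst (asm) sum_nonneg_eq_0_iff) auto
  have Q: "\<eta> j = \<eta> l" if "i \<in> E" "j \<in> E" "l \<in> E" "w i j \<noteq> 0" "w i l \<noteq> 0" for i j l
  proof -
    have "(\<Sum>j\<in>E. \<Sum>l\<in>E. w i j * w i l * (\<eta> l - \<eta> j)\<^sup>2) = 0"
      using z(2) that(1) finite_E w_nonneg
      by (subst (asm) sum_nonneg_eq_0_iff) (auto intro!: sum_nonneg)
    then have "(\<Sum>l\<in>E. w i j * w i l * (\<eta> l - \<eta> j)\<^sup>2) = 0"
      using that(2) finite_E w_nonneg
      by (subst (asm) sum_nonneg_eq_0_iff) (auto intro!: sum_nonneg)
    then have "w i j * w i l * (\<eta> l - \<eta> j)\<^sup>2 = 0"
      using that(3) finite_E w_nonneg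
      by (subst (asm) sum_nonneg_eq_0_iff) auto
    then show ?thesis using that by simp
  qed
  have R: "deg i + deg j = (k + 1) / 2" if "i \<in> E" "j \<in> E" "w i j \<noteq> 0" "\<eta> i \<noteq> \<eta> j" for i j
  proof -
    have "(\<Sum>j\<in>E. ((k + 1) / 2 - deg i - deg j) * w i j * (\<eta> i - \<eta> j)\<^sup>2) = 0"
      using z(3) that(1) finite_E defect_nonneg
      by (subst (asm) sum_nonneg_eq_0_iff) (auto intro!: sum_nonneg)
    then have "((k + 1) / 2 - deg i - deg j) * w i j * (\<eta> i - \<eta> j)\<^sup>2 = 0"
      using that(1,2) finite_E defect_nonneg
      by (subst (asm) sum_nonneg_eq_0_iff) auto
    then have "(k + 1) / 2 - deg i - deg j = 0" using that by simp
    then show ?thesis by linarith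
  qed
  \<comment> \<open>By \<open>R\<close> the two degrees exhaust the bound of
    \<open>deg_add_le\<close>, leaving no weight for an edge disjoint from \<open>i\<close> and
    \<open>j\<close>.\<close>
  have meets: "a = i \<or> a = j \<or> b = i \<or> b = j"
    if ij: "i \<in> E" "j \<in> E" "w i j \<noteq> 0" "\<eta> i \<noteq> \<eta> j" and ab: "a \<in> E" "b \<in> E" "w a b \<noteq> 0" for i j a b
  proof (rule ccontr)
    assume neg: "\<not> ?thesis"
    have "i \<noteq> j" using ij by auto
    then have "(\<Sum>u\<in>E-{i,j}. \<Sum>v\<in>E-{i,j}. w u v) \<le> 0"
      using deg_add_le[of i j] R[OF ij] ij by linarith
    then have "(\<Sum>u\<in>E-{i,j}. \<Sum>v\<in>E-{i,j}. w u v) = 0"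
      by (intro antisym sum_nonneg w_nonneg)
    then have "(\<Sum>v\<in>E-{i,j}. w a v) = 0"
      using neg ab(1) finite_E w_nonneg
      by (subst (asm) sum_nonneg_eq_0_iff) (auto intro!: sum_nonneg)
    then have "w a b = 0"
      using neg ab(2) finite_E w_nonneg by (subst (asm) sum_nonneg_eq_0_iff) auto
    with ab show False by simp
  qed
  \<comment> \<open>The energy is positive because \<open>\<eta>\<close> is not zero, so
    \<open>\<eta>\<close> varies along some edge.\<close>
  have "(\<Sum>i\<in>E. (\<eta> i)\<^sup>2) > 0"
    using nz finite_E by (intro sum_pos2[of E i0]) auto
  then have "energy \<eta> > 0" using eq k_nonneg by simp
  moreover have "energy \<eta> = 0" if "\<forall>u\<in>E. \<forall>v\<in>E. w u v = 0 \<or> \<eta> u = \<eta> v"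
    unfolding energy_def using that by (intro sum.neutral ballI) auto
  ultimately obtain u v where uv: "u \<in> E" "v \<in> E" "w u v \<noteq> 0" "\<eta> u \<noteq> \<eta> v"
    by fastforce
  \<comment> \<open>If neither end of \<open>u v\<close> is a centre, \<open>meets\<close> yields
    edges \<open>v y\<close> and \<open>u x\<close>. Then \<open>Q\<close> gives
    \<open>\<eta> y = \<eta> u\<close> and \<open>\<eta> x = \<eta> v\<close>, and the varying edge
    \<open>v y\<close> must meet \<open>u x\<close>, so \<open>x = y\<close> and
    \<open>\<eta> u = \<eta> v\<close>.\<close>
  have star: "(\<forall>i\<in>E. \<forall>j\<in>E. w i j \<noteq> 0 \<longrightarrow> i = u \<or> j = u) \<or> (\<forall>i\<in>E. \<forall>j\<in>E. w i j \<noteq> 0 \<longrightarrow> i = v \<or> j = v)"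
  proof (rule ccontr)
    assume "\<not> ?thesis"
    then obtain a b a' b' where ab: "a \<in> E" "b \<in> E" "w a b \<noteq> 0" "a \<noteq> u" "b \<noteq> u"
      and ab': "a' \<in> E" "b' \<in> E" "w a' b' \<noteq> 0" "a' \<noteq> v" "b' \<noteq> v" by blast
    from meets[OF uv ab(1-3)] ab(4,5) have "a = v \<or> b = v" by auto
    then obtain y where y: "y \<in> E" "w v y \<noteq> 0" "y \<noteq> u"
      using ab w_sym[of a b] by auto
    from meets[OF uv ab'(1-3)] ab'(4,5) have "a' = u \<or> b' = u" by auto
    then obtain x where x: "x \<in> E" "w u x \<noteq> 0" "x \<noteq> v"
      using ab' w_sym[of a' b'] by auto
    have "\<eta> y = \<eta> u" using Q[of v y u] y uv w_sym[of u v] by simp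
    have "\<eta> x = \<eta> v" using Q[of u x v] x uv by simp
    have "x = y"
      using meets[of v y u x] x y uv \<open>\<eta> y = \<eta> u\<close> by auto
    with \<open>\<eta> y = \<eta> u\<close> \<open>\<eta> x = \<eta> v\<close> uv show False by simp
  qed
  have main: thesis if u: "u \<in> E" "v \<in> E" "w u v \<noteq> 0" "\<eta> u \<noteq> \<eta> v"
    and st: "\<And>i j. i \<in> E \<Longrightarrow> j \<in> E \<Longrightarrow> w i j \<noteq> 0 \<Longrightarrow> i = u \<or> j = u" for u v
  proof (rule extremal[of u])
    show "u \<in> E" by fact
    show "i = u \<or> j = u" if "i \<in> E" "j \<in> E" "w i j \<noteq> 0" for i j using st that by blast
    show "w i j = 0" if ij: "i \<in> E" "j \<in> E" "\<eta> i = 0" for i j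
    proof (rule ccontr)
      assume w: "w i j \<noteq> 0"
      \<comment> \<open>One end is the centre \<open>u\<close>; the other shares its value with
        \<open>v\<close> by \<open>Q\<close>, so \<open>\<eta>\<close> varies along this edge as it
        does along \<open>u v\<close>.\<close>
      have "\<eta> i \<noteq> \<eta> j"
        using st[OF ij(1,2) w] Q[of u j v] Q[of u i v] u w w_sym[of i j] ij by metis
      \<comment> \<open>All neighbours of \<open>i\<close> share the value \<open>\<eta> j\<close>.
        As \<open>\<eta> i = 0\<close>, the eigenvector equation \<open>P\<close> then forces
        \<open>deg i\<close> to vanish.\<close>
      have "lap \<eta> i = (\<Sum>l\<in>E. w i l * (\<eta> i - \<eta> j))"
        unfolding lap_def using Q[OF ij(1) _ ij(2) _ w] by (intro sum.cong) auto
      also have "\<dots> = deg i * (\<eta> i - \<eta> j)" by (simp add: deg_def sum_distrib_right)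
      finally have "deg i = 0" using P[OF ij(1)] ij \<open>\<eta> i \<noteq> \<eta> j\<close> by simp
      then show False
        using w ij finite_E w_nonneg by (simp add: deg_def sum_nonneg_eq_0_iff)
    qed
    \<comment> \<open>By \<open>R\<close> twice the sum of the two degrees is \<open>k + 1\<close>,
      and the overlap subtracted in the count is at most 1.\<close>
    have "k \<le> (\<Sum>i\<in>E. \<Sum>j\<in>E. w i j)"
    proof -
      have "u \<noteq> v" using u by auto
      note sum_split_two_rows_columns[of E w u v, OF finite_E w_nonneg w_sym w_diag u(1,2) this]
      moreover have "0 \<le> (\<Sum>a\<in>E-{u,v}. \<Sum>b\<in>E-{u,v}. w a b)" by (intro sum_nonneg w_nonneg)
      ultimately show ?thesis
        using R[OF u] w_le[OF u(1,2)] by (simp add: deg_def)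
    qed
    with w_total show "(\<Sum>i\<in>E. \<Sum>j\<in>E. w i j) = k" by simp
  qed
  from star show thesis
  proof
    assume "\<forall>i\<in>E. \<forall>j\<in>E. w i j \<noteq> 0 \<longrightarrow> i = u \<or> j = u"
    then show thesis by (intro main[OF uv]) blast
  next
    assume "\<forall>i\<in>E. \<forall>j\<in>E. w i j \<noteq> 0 \<longrightarrow> i = v \<or> j = v"
    then show thesis
      using uv w_sym[of u v] by (intro main[of v u]) auto
  qed
qed

end

subsection \<open>Commutators with an orthonormal family\<close>

text \<open>The Hilbert-Schmidt inner product: for linear operators the sum of products of matrix
  entries in any orthonormal basis, see \<open>hs_inner_orthonormal_basis\<close>.\<close>

definition hs_inner :: "('a::euclidean_space \<Rightarrow> 'a) \<Rightarrow> ('a \<Rightarrow> 'a) \<Rightarrow> real" where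
  "hs_inner S T = (\<Sum>e\<in>Basis. S e \<bullet> T e)"

definition self_adjoint :: "('a::euclidean_space \<Rightarrow> 'a) \<Rightarrow> bool" where
  "self_adjoint T \<longleftrightarrow> linear T \<and> (\<forall>x y. T x \<bullet> y = x \<bullet> T y)"

lemma hs_inner_commute: "hs_inner S T = hs_inner T S"
  by (simp add: hs_inner_def inner_commute)

lemma hs_inner_scaleR:
  "hs_inner (\<lambda>x. a *\<^sub>R S x) (\<lambda>x. b *\<^sub>R T x) = a * b * hs_inner S T"
  by (simp add: hs_inner_def sum_distrib_left mult_ac)

lemma hs_inner_nonneg: "0 \<le> hs_inner T T"
  by (simp add: hs_inner_def sum_nonneg)

lemma hs_inner_eq_0:
  assumes "linear T" "hs_inner T T = 0"
  shows "T x = 0"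
proof -
  have "\<forall>e\<in>Basis. T e \<bullet> T e = 0"
    using assms(2) unfolding hs_inner_def by (subst (asm) sum_nonneg_eq_0_iff) auto
  then have "T (\<Sum>e\<in>Basis. (x \<bullet> e) *\<^sub>R e) = 0"
    by (simp add: linear_sum[OF assms(1)] linear_cmul[OF assms(1)])
  then show ?thesis by (simp add: euclidean_representation)
qed

lemma hs_inner_orthonormal_basis:
  assumes "linear S" "linear T" "orthonormal_basis E"
  shows "hs_inner S T = (\<Sum>e\<in>E. \<Sum>f\<in>E. (S e \<bullet> f) * (T e \<bullet> f))"
proof -
  have "bilinear (\<lambda>x y. S x \<bullet> T y)"
    using assms(1,2) unfolding bilinear_def linear_iff
    by (simp add: inner_add_left inner_add_right)
  from orthonormal_basis_sum[OF assms(3) this] show ?thesis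
    by (simp add: hs_inner_def flip: orthonormal_basis_Parseval[OF assms(3)])
qed

lemma linear_commutator:
  assumes "linear A" "linear B" shows "linear (commutator A B)"
  using assms by (auto simp: linear_iff commutator_def algebra_simps)

lemma commutator_scaleR:
  assumes "linear A" "linear B"
  shows "commutator (\<lambda>x. a *\<^sub>R A x) (\<lambda>x. b *\<^sub>R B x) = (\<lambda>x. (a * b) *\<^sub>R commutator A B x)"
  by (auto simp: commutator_def linear_cmul[OF assms(1)] linear_cmul[OF assms(2)] algebra_simps)

lemma hs_inner_commutator_swap:
  "hs_inner (commutator A B) (commutator A B) = hs_inner (commutator B A) (commutator B A)"
  unfolding hs_inner_def commutator_def
  by (intro sum.cong refl) (simp add: inner_diff_left inner_diff_right)

text \<open>Diagonal entries are left out: they do not contribute to the commutator with an operator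
  that is diagonal in the basis.\<close>

definition entry_weight :: "'s set \<Rightarrow> ('s \<Rightarrow> 'a::euclidean_space \<Rightarrow> 'a) \<Rightarrow> 'a \<Rightarrow> 'a \<Rightarrow> real" where
  "entry_weight S X i j = (if i = j then 0 else \<Sum>b\<in>S. (X b i \<bullet> j)\<^sup>2)"

text \<open>The squares of all entries add up to the number of unit operators. Keeping the diagonal
  term shows that it vanishes once the weights use up the whole total.\<close>

lemma entry_weight_total:
  assumes "finite S" "orthonormal_basis E"
    and X: "\<And>b. b \<in> S \<Longrightarrow> self_adjoint (X b)"
    and unit: "\<And>b. b \<in> S \<Longrightarrow> hs_inner (X b) (X b) = 1"
  shows "(\<Sum>i\<in>E. \<Sum>j\<in>E. entry_weight S X i j) + (\<Sum>i\<in>E. \<Sum>b\<in>S. (X b i \<bullet> i)\<^sup>2) = card S"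
proof -
  have fin: "finite E" by (rule orthonormal_basis_finite) fact
  have "real (card S) = (\<Sum>b\<in>S. \<Sum>i\<in>E. \<Sum>j\<in>E. (X b i \<bullet> j)\<^sup>2)"
    using X unit hs_inner_orthonormal_basis[OF _ _ assms(2)]
    by (auto simp: self_adjoint_def power2_eq_square)
  also have "\<dots> = (\<Sum>i\<in>E. \<Sum>j\<in>E. \<Sum>b\<in>S. (X b i \<bullet> j)\<^sup>2)"
    by (subst sum.swap, intro sum.cong refl, rule sum.swap)
  also have "\<dots> = (\<Sum>i\<in>E. \<Sum>j\<in>E. entry_weight S X i j + (if i = j then \<Sum>b\<in>S. (X b i \<bullet> i)\<^sup>2 else 0))"
    by (intro sum.cong refl) (auto simp: entry_weight_def)
  also have "\<dots> = (\<Sum>i\<in>E. \<Sum>j\<in>E. entry_weight S X i j) + (\<Sum>i\<in>E. \<Sum>b\<in>S. (X b i \<bullet> i)\<^sup>2)"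
    using fin by (simp add: sum.distrib)
  finally show ?thesis by simp
qed

lemma small_weighted_graph_entry_weight:
  fixes X :: "'s \<Rightarrow> 'a::euclidean_space \<Rightarrow> 'a"
  assumes "finite S" "orthonormal_basis E"
    and X: "\<And>b. b \<in> S \<Longrightarrow> self_adjoint (X b)"
    and orth: "\<And>b b'. b \<in> S \<Longrightarrow> b' \<in> S \<Longrightarrow> hs_inner (X b) (X b') = (if b = b' then 1 else 0)"
  shows "small_weighted_graph E (entry_weight S X) (card S)"
proof
  have fin: "finite E" by (rule orthonormal_basis_finite) fact
  then show "finite E" .
  show "0 \<le> entry_weight S X i j" for i j by (simp add: entry_weight_def sum_nonneg)
  have sym: "X b i \<bullet> j = X b j \<bullet> i" if "b \<in> S" for b i j
    using X[OF that] by (metis self_adjoint_def inner_commute)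
  then show "entry_weight S X i j = entry_weight S X j i" for i j
    by (auto simp: entry_weight_def intro!: sum.cong)
  show "entry_weight S X i i = 0" for i by (simp add: entry_weight_def)
  show "entry_weight S X i j \<le> 1 / 2" if ij: "i \<in> E" "j \<in> E" for i j
  proof (cases "i = j")
    case False
    \<comment> \<open>The symmetric matrix with 1/2 at \<open>(i,j)\<close> and
      \<open>(j,i)\<close>: its squared norm is 1/2 and its product with \<open>X b\<close> is the
      entry \<open>X b i \<bullet> j\<close>, so Bessel's inequality gives the bound.\<close>
    define p :: "'a \<times> 'a \<Rightarrow> real" where "p x = (if x \<in> {(i,j),(j,i)} then 1 / 2 else 0)" for x
    have sum_p: "(\<Sum>x\<in>E\<times>E. if x \<in> {(i,j),(j,i)} then f x else 0) = f (i,j) + f (j,i)" for f :: "'a \<times> 'a \<Rightarrow> real"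
    proof -
      have "(\<Sum>x\<in>E\<times>E. if x \<in> {(i,j),(j,i)} then f x else 0) = (\<Sum>x\<in>{(i,j),(j,i)}. f x)"
        using fin ij by (intro sum.mono_neutral_cong_right) auto
      then show ?thesis using False by simp
    qed
    have "(\<Sum>x\<in>E\<times>E. (X b (fst x) \<bullet> snd x) * (X b' (fst x) \<bullet> snd x)) = (if b = b' then 1 else 0)"
      if "b \<in> S" "b' \<in> S" for b b'
      using orth[OF that] X that assms(2)
      by (simp add: self_adjoint_def hs_inner_orthonormal_basis[of _ _ E] sum.cartesian_product case_prod_beta)
    from Bessel_coordinates[where v = "\<lambda>b x. X b (fst x) \<bullet> snd x" and I = "E\<times>E", OF \<open>finite S\<close> this, of p]
    have "(\<Sum>b\<in>S. (\<Sum>x\<in>E\<times>E. (X b (fst x) \<bullet> snd x) * p x)\<^sup>2) \<le> (\<Sum>x\<in>E\<times>E. (p x)\<^sup>2)" by blast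
    also have "(\<Sum>x\<in>E\<times>E. (p x)\<^sup>2) = (\<Sum>x\<in>E\<times>E. if x \<in> {(i,j),(j,i)} then (1/2)^2 else 0)"
      unfolding p_def by (intro sum.cong refl) auto
    also have "\<dots> = 1 / 2" by (subst sum_p) (simp add: power2_eq_square)
    also have "(\<Sum>b\<in>S. (\<Sum>x\<in>E\<times>E. (X b (fst x) \<bullet> snd x) * p x)\<^sup>2)
        = (\<Sum>b\<in>S. (\<Sum>x\<in>E\<times>E. if x \<in> {(i,j),(j,i)} then (X b (fst x) \<bullet> snd x) / 2 else 0)\<^sup>2)"
      unfolding p_def by (intro sum.cong refl arg_cong[of _ _ "\<lambda>x. x\<^sup>2"]) auto
    also have "\<dots> = entry_weight S X i j"
      using False by (subst sum_p) (auto simp: entry_weight_def sym[of _ j i] intro!: sum.cong)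
    finally show ?thesis .
  qed (simp add: entry_weight_def)
  have "0 \<le> (\<Sum>i\<in>E. \<Sum>b\<in>S. (X b i \<bullet> i)\<^sup>2)" by (intro sum_nonneg) auto
  then show "(\<Sum>i\<in>E. \<Sum>j\<in>E. entry_weight S X i j) \<le> real (card S)"
    using entry_weight_total[of S E X] assms by simp
qed

text \<open>In an eigenbasis of \<open>T\<close> the commutator multiplies each entry of
  \<open>X b\<close> by a difference of eigenvalues.\<close>

lemma energy_entry_weight:
  assumes "finite S" "orthonormal_basis E"
    and X: "\<And>b. b \<in> S \<Longrightarrow> self_adjoint (X b)"
    and orth: "\<And>b b'. b \<in> S \<Longrightarrow> b' \<in> S \<Longrightarrow> hs_inner (X b) (X b') = (if b = b' then 1 else 0)"
    and T: "self_adjoint T" "\<And>e. e \<in> E \<Longrightarrow> T e = \<eta> e *\<^sub>R e"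
  shows "small_weighted_graph.energy E (entry_weight S X) \<eta>
    = (\<Sum>b\<in>S. hs_inner (commutator T (X b)) (commutator T (X b)))"
proof -
  interpret small_weighted_graph E "entry_weight S X" "card S"
    by (rule small_weighted_graph_entry_weight) fact+
  have entry: "commutator T (X b) i \<bullet> j = (\<eta> j - \<eta> i) * (X b i \<bullet> j)"
    if "b \<in> S" "i \<in> E" "j \<in> E" for b i j
  proof -
    have "T (X b i) \<bullet> j = X b i \<bullet> T j" using T(1) by (simp add: self_adjoint_def)
    moreover have "linear (X b)" using X that by (simp add: self_adjoint_def)
    ultimately show ?thesis
      using T(2) that by (simp add: commutator_def inner_diff_left linear_cmul left_diff_distrib)
  qed
  have "energy \<eta> = (\<Sum>i\<in>E. \<Sum>j\<in>E. \<Sum>b\<in>S. ((\<eta> j - \<eta> i) * (X b i \<bullet> j))\<^sup>2)"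
    unfolding energy_def
    by (intro sum.cong refl)
      (auto simp: entry_weight_def power_mult_distrib sum_distrib_left mult.commute power2_commute
        intro!: sum.cong)
  also have "\<dots> = (\<Sum>b\<in>S. \<Sum>i\<in>E. \<Sum>j\<in>E. ((\<eta> j - \<eta> i) * (X b i \<bullet> j))\<^sup>2)"
    by (simp only: sum.swap[where B = S and A = E])
  also have "\<dots> = (\<Sum>b\<in>S. \<Sum>i\<in>E. \<Sum>j\<in>E. (commutator T (X b) i \<bullet> j) * (commutator T (X b) i \<bullet> j))"
    by (intro sum.cong refl) (simp add: entry power2_eq_square)
  also have "\<dots> = (\<Sum>b\<in>S. hs_inner (commutator T (X b)) (commutator T (X b)))"
    using X T(1) assms(2)
    by (intro sum.cong refl hs_inner_orthonormal_basis[symmetric] linear_commutator)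
      (auto simp: self_adjoint_def)
  finally show ?thesis .
qed

lemma hs_inner_diagonal:
  assumes "orthonormal_basis E" "linear T" "\<And>e. e \<in> E \<Longrightarrow> T e = \<eta> e *\<^sub>R e"
  shows "hs_inner T T = (\<Sum>e\<in>E. (\<eta> e)\<^sup>2)"
proof -
  have "hs_inner T T = (\<Sum>e\<in>E. T e \<bullet> T e)"
    unfolding hs_inner_orthonormal_basis[OF assms(2,2,1)]
    by (intro sum.cong refl orthonormal_basis_Parseval[OF assms(1), symmetric])
  also have "\<dots> = (\<Sum>e\<in>E. (\<eta> e)\<^sup>2)"
    using assms(3) orthonormal_basis_inner[OF assms(1)] by (intro sum.cong) (auto simp: power2_eq_square)
  finally show ?thesis .
qed

text \<open>This is \<open>energy_le\<close> in an eigenbasis of \<open>T\<close>, with the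
  eigenvalues as the function on the vertices.\<close>

theorem sum_commutators_le:
  assumes "finite S" "self_adjoint T"
    and X: "\<And>b. b \<in> S \<Longrightarrow> self_adjoint (X b)"
    and orth: "\<And>b b'. b \<in> S \<Longrightarrow> b' \<in> S \<Longrightarrow> hs_inner (X b) (X b') = (if b = b' then 1 else 0)"
  shows "(\<Sum>b\<in>S. hs_inner (commutator T (X b)) (commutator T (X b))) \<le> (real (card S) + 1) * hs_inner T T"
proof -
  have T: "linear T" "\<And>x y. T x \<bullet> y = x \<bullet> T y"
    using assms(2) by (auto simp: self_adjoint_def)
  obtain E where E: "orthonormal_basis E" "\<And>e. e \<in> E \<Longrightarrow> T e = (T e \<bullet> e) *\<^sub>R e"
    using self_adjoint_diagonalizable[OF T] by blast
  interpret small_weighted_graph E "entry_weight S X" "card S"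
    by (rule small_weighted_graph_entry_weight) fact+
  show ?thesis
    using energy_le[of "\<lambda>e. T e \<bullet> e"] energy_entry_weight[OF assms(1) E(1) X orth assms(2) E(2)]
      hs_inner_diagonal[OF E(1) T(1) E(2)] by simp
qed

text \<open>By \<open>energy_extremal\<close> the off-diagonal entries of the \<open>X b\<close>
  form a star, and the diagonal ones vanish. A zero eigenvalue of \<open>T\<close> gives an isolated
  vertex, killed by all operators; otherwise \<open>T\<close> is injective, and a star matrix on at
  least three vertices is singular.\<close>

theorem sum_commutators_extremal:
  fixes T :: "'a::euclidean_space \<Rightarrow> 'a"
  assumes "finite S" "self_adjoint T"
    and X: "\<And>b. b \<in> S \<Longrightarrow> self_adjoint (X b)"
    and orth: "\<And>b b'. b \<in> S \<Longrightarrow> b' \<in> S \<Longrightarrow> hs_inner (X b) (X b') = (if b = b' then 1 else 0)"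
    and eq: "(\<Sum>b\<in>S. hs_inner (commutator T (X b)) (commutator T (X b))) = (real (card S) + 1) * hs_inner T T"
    and nz: "hs_inner T T \<noteq> 0" and dim: "DIM('a) \<ge> 3"
  shows "(\<exists>z. z \<noteq> 0 \<and> T z = 0 \<and> (\<forall>b\<in>S. X b z = 0)) \<or>
         ((\<forall>z. T z = 0 \<longrightarrow> z = 0) \<and> (\<forall>b\<in>S. \<exists>z. z \<noteq> 0 \<and> X b z = 0))"
proof -
  have T: "linear T" "\<And>x y. T x \<bullet> y = x \<bullet> T y"
    using assms(2) by (auto simp: self_adjoint_def)
  obtain E where E: "orthonormal_basis E" "\<And>e. e \<in> E \<Longrightarrow> T e = (T e \<bullet> e) *\<^sub>R e"
    using self_adjoint_diagonalizable[OF T] by blast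
  define \<eta> where "\<eta> e = T e \<bullet> e" for e
  have T\<eta>: "T e = \<eta> e *\<^sub>R e" if "e \<in> E" for e
    unfolding \<eta>_def by (rule E(2)[OF that])
  have fin: "finite E" by (rule orthonormal_basis_finite[OF E(1)])
  interpret small_weighted_graph E "entry_weight S X" "card S"
    by (rule small_weighted_graph_entry_weight) fact+
  have hsT: "hs_inner T T = (\<Sum>e\<in>E. (\<eta> e)\<^sup>2)"
    by (rule hs_inner_diagonal[OF E(1) T(1) T\<eta>])
  have en: "energy \<eta> = (real (card S) + 1) * (\<Sum>i\<in>E. (\<eta> i)\<^sup>2)"
    using eq energy_entry_weight[OF assms(1) E(1) X orth assms(2) T\<eta>] hsT by simp
  obtain i0 where "i0 \<in> E" "\<eta> i0 \<noteq> 0"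
    using nz unfolding hsT by (metis (no_types, lifting) sum.neutral zero_power2)
  then obtain u where u: "u \<in> E" "\<And>i j. i \<in> E \<Longrightarrow> j \<in> E \<Longrightarrow> entry_weight S X i j \<noteq> 0 \<Longrightarrow> i = u \<or> j = u"
    "\<And>i j. i \<in> E \<Longrightarrow> j \<in> E \<Longrightarrow> \<eta> i = 0 \<Longrightarrow> entry_weight S X i j = 0"
    "(\<Sum>i\<in>E. \<Sum>j\<in>E. entry_weight S X i j) = card S"
    using energy_extremal[OF en] by blast
  \<comment> \<open>The weights already account for the full total \<open>card S\<close>, so nothing
    is left for the diagonal.\<close>
  have "(\<Sum>i\<in>E. \<Sum>b\<in>S. (X b i \<bullet> i)\<^sup>2) = 0"
    using entry_weight_total[of S E X] u(4) assms(1) E(1) X orth by simp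
  then have diag: "X b i \<bullet> i = 0" if "b \<in> S" "i \<in> E" for b i
    using that fin \<open>finite S\<close> by (simp add: sum_nonneg_eq_0_iff sum_nonneg)
  have entry: "X b i \<bullet> j = 0" if "b \<in> S" "i \<in> E" "j \<in> E" "entry_weight S X i j = 0" for b i j
  proof (cases "i = j")
    case False
    with that \<open>finite S\<close> show ?thesis by (simp add: entry_weight_def sum_nonneg_eq_0_iff)
  qed (use that diag in simp)
  have nonzero: "e \<noteq> 0" if "e \<in> E" for e
    using orthonormal_basis_inner[OF E(1) that that] by auto
  have zeroI: "x = 0" if "\<And>e. e \<in> E \<Longrightarrow> x \<bullet> e = 0" for x
    using orthonormal_basis_expansion[OF E(1), of x] that by simp
  show ?thesis
  proof (cases "\<exists>z\<in>E. \<eta> z = 0")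
    case True
    then obtain z where z: "z \<in> E" "\<eta> z = 0" by blast
    then have "X b z = 0" if "b \<in> S" for b
      using entry[OF that] u(3) by (intro zeroI) blast
    then show ?thesis using z T\<eta> nonzero by force
  next
    case False
    have "z = 0" if "T z = 0" for z
    proof (rule zeroI)
      fix e assume e: "e \<in> E"
      have "0 = \<eta> e * (z \<bullet> e)" using T(2)[of z e] T\<eta>[OF e] that by simp
      then show "z \<bullet> e = 0" using False e by simp
    qed
    moreover have "\<exists>z. z \<noteq> 0 \<and> X b z = 0" if b: "b \<in> S" for b
    proof -
      have lin: "linear (X b)" using X[OF b] by (simp add: self_adjoint_def)
      \<comment> \<open>Off the centre \<open>X b\<close> maps into the line through
        \<open>u\<close>, so two leaves have a nontrivial combination in the kernel.\<close>
      have "card (E - {u}) \<ge> 2"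
        using E(1) u(1) dim by (simp add: orthonormal_basis_def)
      then obtain l1 l2 where l: "l1 \<in> E" "l2 \<in> E" "l1 \<noteq> u" "l2 \<noteq> u" "l1 \<noteq> l2"
        by (auto simp: card_2_iff elim!: obtain_subset_with_card_n)
      have Xl: "X b l = (X b l \<bullet> u) *\<^sub>R u" if "l \<in> E" "l \<noteq> u" for l
      proof -
        have "X b l = (\<Sum>e\<in>E. (X b l \<bullet> e) *\<^sub>R e)"
          by (rule orthonormal_basis_expansion[OF E(1)])
        also have "\<dots> = (\<Sum>e\<in>E. if e = u then (X b l \<bullet> u) *\<^sub>R u else 0)"
          using entry[OF b that(1)] u(2)[OF that(1)] that(2) by (intro sum.cong refl) auto
        finally show ?thesis using fin u(1) by simp
      qed
      define p q where "p = X b l1 \<bullet> u" and "q = X b l2 \<bullet> u"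
      have pq: "X b l1 = p *\<^sub>R u" "X b l2 = q *\<^sub>R u"
        unfolding p_def q_def by (intro Xl l)+
      show ?thesis
      proof (cases "p = 0")
        case True
        with pq(1) nonzero[OF l(1)] show ?thesis by auto
      next
        case False
        have "(q *\<^sub>R l1 - p *\<^sub>R l2) \<bullet> l2 = - p"
          using l orthonormal_basis_inner[OF E(1)] by (simp add: inner_diff_left)
        with False have "q *\<^sub>R l1 - p *\<^sub>R l2 \<noteq> 0" by fastforce
        moreover have "X b (q *\<^sub>R l1 - p *\<^sub>R l2) = 0"
          by (simp add: linear_diff[OF lin] linear_cmul[OF lin] pq mult.commute)
        ultimately show ?thesis by blast
      qed
    qed
    ultimately show ?thesis by blast
  qed
qed

subsection \<open>The DDVV inequality\<close>

text \<open>Raising all variables by \<open>\<mu>\<close> adds cross terms, which the row bound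
  controls. The slack in the constant term is retained for the equality case.\<close>

lemma shifted_quadratic_form_le:
  fixes c :: "'i \<Rightarrow> 'i \<Rightarrow> real"
  assumes sym: "\<And>a b. c a b = c b a" and row: "\<And>a. a \<in> M \<Longrightarrow> (\<Sum>b\<in>M. c a b) \<le> card M"
    and y: "\<And>a. a \<in> M \<Longrightarrow> 0 \<le> y a" and "0 \<le> \<mu>"
    and le: "(\<Sum>a\<in>M. \<Sum>b\<in>M. y a * y b * c a b) \<le> (\<Sum>a\<in>M. y a)\<^sup>2"
  shows "(\<Sum>a\<in>M. \<Sum>b\<in>M. (y a + \<mu>) * (y b + \<mu>) * c a b)
    \<le> (\<Sum>a\<in>M. y a + \<mu>)\<^sup>2 - \<mu>\<^sup>2 * ((real (card M))\<^sup>2 - (\<Sum>a\<in>M. \<Sum>b\<in>M. c a b))"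
proof -
  have swap: "(\<Sum>a\<in>M. \<Sum>b\<in>M. y b * c a b) = (\<Sum>a\<in>M. \<Sum>b\<in>M. y a * c a b)"
    by (subst sum.swap) (simp add: sym)
  have cross: "(\<Sum>a\<in>M. \<Sum>b\<in>M. y a * c a b) \<le> (\<Sum>a\<in>M. y a) * card M"
    unfolding sum_distrib_right sum_distrib_left[symmetric]
    by (intro sum_mono mult_left_mono row y)
  have "(\<Sum>a\<in>M. \<Sum>b\<in>M. (y a + \<mu>) * (y b + \<mu>) * c a b)
      = (\<Sum>a\<in>M. \<Sum>b\<in>M. y a * y b * c a b) + \<mu> * (\<Sum>a\<in>M. \<Sum>b\<in>M. y a * c a b)
        + \<mu> * (\<Sum>a\<in>M. \<Sum>b\<in>M. y b * c a b) + \<mu>\<^sup>2 * (\<Sum>a\<in>M. \<Sum>b\<in>M. c a b)"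
    by (simp add: sum_distrib_left flip: sum.distrib) (simp add: algebra_simps power2_eq_square)
  also have "\<dots> \<le> (\<Sum>a\<in>M. y a)\<^sup>2 + 2 * \<mu> * ((\<Sum>a\<in>M. y a) * card M) + \<mu>\<^sup>2 * (\<Sum>a\<in>M. \<Sum>b\<in>M. c a b)"
    using le mult_left_mono[OF cross \<open>0 \<le> \<mu>\<close>] unfolding swap by (simp add: algebra_simps)
  also have "\<dots> = (\<Sum>a\<in>M. y a + \<mu>)\<^sup>2 - \<mu>\<^sup>2 * ((real (card M))\<^sup>2 - (\<Sum>a\<in>M. \<Sum>b\<in>M. c a b))"
    by (simp add: sum.distrib power2_eq_square algebra_simps)
  finally show ?thesis .
qed

text \<open>Subtracting the minimum makes one variable zero, so its index drops out and induction
  applies; \<open>shifted_quadratic_form_le\<close> restores the minimum. Under equality with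
  positive variables the retained slack vanishes, which makes every row bound sharp.\<close>

lemma quadratic_form_le:
  fixes c :: "'i \<Rightarrow> 'i \<Rightarrow> real"
  assumes "finite M" and sym: "\<And>a b. c a b = c b a" and diag: "\<And>a. c a a = 0"
    and row: "\<And>a S. a \<in> M \<Longrightarrow> S \<subseteq> M - {a} \<Longrightarrow> (\<Sum>b\<in>S. c a b) \<le> real (card S) + 1"
    and x: "\<And>a. a \<in> M \<Longrightarrow> 0 \<le> x a"
  shows "(\<Sum>a\<in>M. \<Sum>b\<in>M. x a * x b * c a b) \<le> (\<Sum>a\<in>M. x a)\<^sup>2"
    and "\<And>a. (\<And>a. a \<in> M \<Longrightarrow> 0 < x a) \<Longrightarrow>
      (\<Sum>a\<in>M. \<Sum>b\<in>M. x a * x b * c a b) = (\<Sum>a\<in>M. x a)\<^sup>2 \<Longrightarrow> a \<in> M \<Longrightarrow>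
      (\<Sum>b\<in>M-{a}. c a b) = real (card (M - {a})) + 1"
proof -
  \<comment> \<open>Stated for any index set, with the smaller cases as the premise
    \<open>IH\<close>: this serves the induction and, with \<open>le\<close> in place of
    \<open>IH\<close>, the equality case.\<close>
  have main: "(\<Sum>a\<in>M. \<Sum>b\<in>M. x a * x b * c a b)
      \<le> (\<Sum>a\<in>M. x a)\<^sup>2 - \<mu>\<^sup>2 * ((real (card M))\<^sup>2 - (\<Sum>a\<in>M. \<Sum>b\<in>M. c a b)) \<and>
      (\<forall>a\<in>M. (\<Sum>b\<in>M. c a b) \<le> card M)"
    if "M \<noteq> {}" and \<mu>: "\<mu> = Min (x ` M)"
      and IH: "\<And>M' y. card M' < card M \<Longrightarrow> M' \<subseteq> M \<Longrightarrow> (\<And>a. a \<in> M' \<Longrightarrow> 0 \<le> y a) \<Longrightarrow>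
        (\<Sum>a\<in>M'. \<Sum>b\<in>M'. y a * y b * c a b) \<le> (\<Sum>a\<in>M'. y a)\<^sup>2"
      and M: "finite M" "\<And>a S. a \<in> M \<Longrightarrow> S \<subseteq> M - {a} \<Longrightarrow> (\<Sum>b\<in>S. c a b) \<le> real (card S) + 1"
      and x: "\<And>a. a \<in> M \<Longrightarrow> 0 \<le> x a"
    for M :: "'i set" and x \<mu>
  proof -
    define y where "y a = x a - \<mu>" for a
    have "\<mu> \<in> x ` M" unfolding \<mu> using \<open>M \<noteq> {}\<close> M(1) by (intro Min_in) auto
    then obtain a0 where a0: "a0 \<in> M" "\<mu> = x a0" by blast
    have y: "0 \<le> y a" if "a \<in> M" for a
      using that \<mu> M(1) by (simp add: y_def)
    \<comment> \<open>Since \<open>c a a = 0\<close>, only \<open>card M - 1\<close> entries of the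
      row count, and the bound becomes \<open>card M\<close>.\<close>
    have row: "(\<Sum>b\<in>M. c a b) \<le> card M" if "a \<in> M" for a
    proof -
      have "card M > 0" using that M(1) card_gt_0_iff by blast
      then show ?thesis
        using M(2)[OF that order_refl] that M(1)
        by (simp add: sum.remove[of M a] diag of_nat_diff)
    qed
    have drop: "(\<Sum>a\<in>M. f a) = (\<Sum>a\<in>M-{a0}. f a)" if "f a0 = 0" for f :: "'i \<Rightarrow> real"
      using a0 M(1) that by (simp add: sum.remove[of M a0])
    have "y a0 = 0" using a0 by (simp add: y_def)
    then have "(\<Sum>a\<in>M. \<Sum>b\<in>M. y a * y b * c a b) = (\<Sum>a\<in>M-{a0}. \<Sum>b\<in>M-{a0}. y a * y b * c a b)"
      by (subst drop) (auto intro!: sum.cong drop)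
    also have "\<dots> \<le> (\<Sum>a\<in>M-{a0}. y a)\<^sup>2"
      using a0 M(1) y card_Diff1_less[of M a0] by (intro IH) auto
    also have "(\<Sum>a\<in>M-{a0}. y a) = (\<Sum>a\<in>M. y a)" using drop[of y] \<open>y a0 = 0\<close> by simp
    finally have "(\<Sum>a\<in>M. \<Sum>b\<in>M. (y a + \<mu>) * (y b + \<mu>) * c a b)
      \<le> (\<Sum>a\<in>M. y a + \<mu>)\<^sup>2 - \<mu>\<^sup>2 * ((real (card M))\<^sup>2 - (\<Sum>a\<in>M. \<Sum>b\<in>M. c a b))"
      using a0 x y row sym by (intro shifted_quadratic_form_le) auto
    with row show ?thesis by (simp add: y_def)
  qed
  have slack: "0 \<le> \<mu>\<^sup>2 * ((real (card M))\<^sup>2 - (\<Sum>a\<in>M. \<Sum>b\<in>M. c a b))"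
    if "\<forall>a\<in>M. (\<Sum>b\<in>M. c a b) \<le> card M" for M \<mu>
    using sum_bounded_above[of M "\<lambda>a. \<Sum>b\<in>M. c a b" "card M"] that
    by (intro mult_nonneg_nonneg) (auto simp: power2_eq_square)
  have le: "(\<Sum>a\<in>M'. \<Sum>b\<in>M'. y a * y b * c a b) \<le> (\<Sum>a\<in>M'. y a)\<^sup>2"
    if "M' \<subseteq> M" "\<And>a. a \<in> M' \<Longrightarrow> 0 \<le> y a" for M' y
    using that
  proof (induction "card M'" arbitrary: M' y rule: less_induct)
    case less
    show ?case
    proof (cases "M' = {}")
      case False
      have "finite M'" using less(2) \<open>finite M\<close> finite_subset by blast
      have "(\<Sum>b\<in>S. c a b) \<le> real (card S) + 1" if "a \<in> M'" "S \<subseteq> M' - {a}" for a S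
        using that less(2) by (intro row) auto
      with main[OF False refl, of y] less \<open>finite M'\<close>
      have "(\<Sum>a\<in>M'. \<Sum>b\<in>M'. y a * y b * c a b)
        \<le> (\<Sum>a\<in>M'. y a)\<^sup>2 - (Min (y ` M'))\<^sup>2 * ((real (card M'))\<^sup>2 - (\<Sum>a\<in>M'. \<Sum>b\<in>M'. c a b)) \<and>
        (\<forall>a\<in>M'. (\<Sum>b\<in>M'. c a b) \<le> card M')"
        by (smt (verit) subset_trans)
      with slack[of M' "Min (y ` M')"] show ?thesis by linarith
    qed simp
  qed
  from le[OF order_refl x] show "(\<Sum>a\<in>M. \<Sum>b\<in>M. x a * x b * c a b) \<le> (\<Sum>a\<in>M. x a)\<^sup>2" .
  fix a assume pos: "\<And>a. a \<in> M \<Longrightarrow> 0 < x a"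
    and eq: "(\<Sum>a\<in>M. \<Sum>b\<in>M. x a * x b * c a b) = (\<Sum>a\<in>M. x a)\<^sup>2" and a: "a \<in> M"
  define \<mu> where "\<mu> = Min (x ` M)"
  have "M \<noteq> {}" using a by auto
  then have "\<mu> > 0" using pos \<open>finite M\<close> by (simp add: \<mu>_def)
  from main[OF \<open>M \<noteq> {}\<close> \<mu>_def le \<open>finite M\<close> row x]
  have m: "(\<Sum>a\<in>M. \<Sum>b\<in>M. x a * x b * c a b)
      \<le> (\<Sum>a\<in>M. x a)\<^sup>2 - \<mu>\<^sup>2 * ((real (card M))\<^sup>2 - (\<Sum>a\<in>M. \<Sum>b\<in>M. c a b))"
    and rows: "\<forall>a\<in>M. (\<Sum>b\<in>M. c a b) \<le> card M" by blast+
  \<comment> \<open>As \<open>\<mu> > 0\<close>, the row deficits sum to at most 0; each of them is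
    nonnegative, so all vanish.\<close>
  have "\<mu>\<^sup>2 * ((real (card M))\<^sup>2 - (\<Sum>a\<in>M. \<Sum>b\<in>M. c a b)) \<le> 0" using m eq by linarith
  then have "(\<Sum>a\<in>M. real (card M) - (\<Sum>b\<in>M. c a b)) \<le> 0"
    using \<open>\<mu> > 0\<close> by (simp add: mult_le_0_iff sum_subtractf power2_eq_square)
  moreover have "real (card M) - (\<Sum>b\<in>M. c a b) \<le> (\<Sum>a\<in>M. real (card M) - (\<Sum>b\<in>M. c a b))"
    using rows \<open>finite M\<close> a by (intro member_le_sum) auto
  ultimately have "(\<Sum>b\<in>M. c a b) = real (card M)" using rows a by force
  moreover have "card M > 0" using a \<open>finite M\<close> card_gt_0_iff by blast
  ultimately show "(\<Sum>b\<in>M-{a}. c a b) = real (card (M - {a})) + 1"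
    using a \<open>finite M\<close> by (simp add: sum.remove[of M a] diag of_nat_diff)
qed

text \<open>The unit operators \<open>U\<close> turn \<open>K\<close> into the quadratic form of
  \<open>quadratic_form_le\<close> in the squared norms, with row bounds from
  \<open>sum_commutators_le\<close>. For equality the dichotomy of
  \<open>sum_commutators_extremal\<close> is compared at two indices.\<close>

lemma DDVV_orthogonal:
  fixes X :: "'s \<Rightarrow> 'a::euclidean_space \<Rightarrow> 'a"
  assumes "finite F" and X: "\<And>\<xi>. \<xi> \<in> F \<Longrightarrow> self_adjoint (X \<xi>)"
    and orth: "\<And>\<xi> \<eta>. \<xi> \<in> F \<Longrightarrow> \<eta> \<in> F \<Longrightarrow> \<xi> \<noteq> \<eta> \<Longrightarrow> hs_inner (X \<xi>) (X \<eta>) = 0"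
  defines "K \<equiv> \<Sum>\<xi>\<in>F. \<Sum>\<eta>\<in>F. hs_inner (commutator (X \<xi>) (X \<eta>)) (commutator (X \<xi>) (X \<eta>))"
    and "N \<equiv> \<Sum>\<xi>\<in>F. hs_inner (X \<xi>) (X \<xi>)"
  shows "K \<le> N\<^sup>2"
    and "K = N\<^sup>2 \<Longrightarrow> N \<noteq> 0 \<Longrightarrow> DIM('a) \<ge> 3 \<Longrightarrow> \<exists>z. z \<noteq> 0 \<and> (\<forall>\<xi>\<in>F. X \<xi> z = 0)"
proof -
  define x where "x \<xi> = hs_inner (X \<xi>) (X \<xi>)" for \<xi>
  \<comment> \<open>Zero operators cannot be normalized; they contribute nothing to \<open>K\<close>
    or \<open>N\<close>.\<close>
  define M where "M = {\<xi> \<in> F. x \<xi> \<noteq> 0}"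
  define U where "U \<xi> = (\<lambda>v. (1 / sqrt (x \<xi>)) *\<^sub>R X \<xi> v)" for \<xi>
  define c where "c \<xi> \<eta> = hs_inner (commutator (U \<xi>) (U \<eta>)) (commutator (U \<xi>) (U \<eta>))" for \<xi> \<eta>
  have "finite M" using \<open>finite F\<close> by (simp add: M_def)
  have x_pos: "0 < x \<xi>" if "\<xi> \<in> M" for \<xi>
    using that hs_inner_nonneg[of "X \<xi>"] by (auto simp: M_def x_def)
  have lin: "linear (X \<xi>)" if "\<xi> \<in> F" for \<xi>
    using X[OF that] by (simp add: self_adjoint_def)
  have zero: "X \<xi> = (\<lambda>v. 0)" if "\<xi> \<in> F - M" for \<xi>
    using hs_inner_eq_0[OF lin] that by (auto simp: M_def x_def)
  have U: "self_adjoint (U \<xi>)" if "\<xi> \<in> M" for \<xi>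
    using X[of \<xi>] that unfolding self_adjoint_def linear_iff U_def M_def
    by (auto simp: scaleR_add_right)
  have U_orth: "hs_inner (U \<xi>) (U \<eta>) = (if \<xi> = \<eta> then 1 else 0)" if "\<xi> \<in> M" "\<eta> \<in> M" for \<xi> \<eta>
    using orth[of \<xi> \<eta>] that x_pos[of \<xi>] unfolding U_def hs_inner_scaleR
    by (auto simp: M_def simp flip: x_def)
  have X_comm: "hs_inner (commutator (X \<xi>) (X \<eta>)) (commutator (X \<xi>) (X \<eta>)) = x \<xi> * x \<eta> * c \<xi> \<eta>"
    if "\<xi> \<in> M" "\<eta> \<in> M" for \<xi> \<eta>
  proof -
    have "sqrt (x \<xi>) * sqrt (x \<eta>) * (sqrt (x \<xi>) * sqrt (x \<eta>)) = (sqrt (x \<xi>))\<^sup>2 * (sqrt (x \<eta>))\<^sup>2"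
      by (simp only: power2_eq_square mult_ac)
    also have "\<dots> = x \<xi> * x \<eta>" using x_pos[OF that(1)] x_pos[OF that(2)] by simp
    finally show ?thesis
      using that x_pos[of \<xi>] x_pos[of \<eta>] lin[of \<xi>] lin[of \<eta>]
      unfolding c_def U_def by (simp add: commutator_scaleR hs_inner_scaleR M_def)
  qed
  have comm_zero: "hs_inner (commutator (X \<xi>) (X \<eta>)) (commutator (X \<xi>) (X \<eta>)) = 0"
    if "\<xi> \<in> F" "\<eta> \<in> F" "\<xi> \<notin> M \<or> \<eta> \<notin> M" for \<xi> \<eta>
    using that zero[of \<xi>] zero[of \<eta>] lin[of \<xi>] lin[of \<eta>]
    by (auto simp: hs_inner_def commutator_def linear_0)
  have K: "K = (\<Sum>\<xi>\<in>M. \<Sum>\<eta>\<in>M. x \<xi> * x \<eta> * c \<xi> \<eta>)"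
  proof -
    have "K = (\<Sum>\<xi>\<in>M. \<Sum>\<eta>\<in>F. hs_inner (commutator (X \<xi>) (X \<eta>)) (commutator (X \<xi>) (X \<eta>)))"
      unfolding K_def using \<open>finite F\<close> comm_zero
      by (intro sum.mono_neutral_right) (auto simp: M_def intro!: sum.neutral)
    also have "\<dots> = (\<Sum>\<xi>\<in>M. \<Sum>\<eta>\<in>M. x \<xi> * x \<eta> * c \<xi> \<eta>)"
      using \<open>finite F\<close> comm_zero X_comm
      by (intro sum.cong refl sum.mono_neutral_cong_right) (auto simp: M_def)
    finally show ?thesis .
  qed
  have N: "N = (\<Sum>\<xi>\<in>M. x \<xi>)"
    unfolding N_def x_def[symmetric] using \<open>finite F\<close>
    by (intro sum.mono_neutral_right) (auto simp: M_def)
  have c_sym: "c \<xi> \<eta> = c \<eta> \<xi>" for \<xi> \<eta>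
    unfolding c_def by (rule hs_inner_commutator_swap)
  have c_diag: "c \<xi> \<xi> = 0" for \<xi> by (simp add: c_def hs_inner_def commutator_def)
  have c_row: "(\<Sum>\<eta>\<in>S. c \<xi> \<eta>) \<le> real (card S) + 1" if "\<xi> \<in> M" "S \<subseteq> M - {\<xi>}" for \<xi> S
    using sum_commutators_le[of S "U \<xi>" U] U U_orth that finite_subset[OF that(2)] \<open>finite M\<close>
    unfolding c_def by (simp add: subset_iff)
  have x_nonneg: "0 \<le> x \<xi>" for \<xi> by (simp add: x_def hs_inner_nonneg)
  note quad = quadratic_form_le[of M c x, OF \<open>finite M\<close> c_sym c_diag c_row x_nonneg]
  from quad(1) show "K \<le> N\<^sup>2" unfolding K N .
  assume eq: "K = N\<^sup>2" and "N \<noteq> 0" and dim: "DIM('a) \<ge> 3"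
  have alt: "(\<exists>z. z \<noteq> 0 \<and> U \<xi> z = 0 \<and> (\<forall>\<eta>\<in>M-{\<xi>}. U \<eta> z = 0)) \<or>
      ((\<forall>z. U \<xi> z = 0 \<longrightarrow> z = 0) \<and> (\<forall>\<eta>\<in>M-{\<xi>}. \<exists>z. z \<noteq> 0 \<and> U \<eta> z = 0))" if "\<xi> \<in> M" for \<xi>
  proof (rule sum_commutators_extremal)
    show "finite (M - {\<xi>})" using \<open>finite M\<close> by simp
    show "(\<Sum>\<eta>\<in>M-{\<xi>}. hs_inner (commutator (U \<xi>) (U \<eta>)) (commutator (U \<xi>) (U \<eta>)))
        = (real (card (M - {\<xi>})) + 1) * hs_inner (U \<xi>) (U \<xi>)"
      using quad(2)[of \<xi>] x_pos eq that U_orth[of \<xi> \<xi>] unfolding K N by (simp add: c_def)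
  qed (use U U_orth that dim in auto)
  have U_zero: "U \<eta> z = 0 \<longleftrightarrow> X \<eta> z = 0" if "\<eta> \<in> M" for \<eta> z
    using x_pos[OF that] by (simp add: U_def)
  obtain \<xi> where \<xi>: "\<xi> \<in> M" using \<open>N \<noteq> 0\<close> unfolding N by (metis sum.empty ex_in_conv)
  show "\<exists>z. z \<noteq> 0 \<and> (\<forall>\<xi>\<in>F. X \<xi> z = 0)"
  proof (cases "\<exists>z. z \<noteq> 0 \<and> U \<xi> z = 0 \<and> (\<forall>\<eta>\<in>M-{\<xi>}. U \<eta> z = 0)")
    case True
    then obtain z where z: "z \<noteq> 0" "\<forall>\<eta>\<in>M. U \<eta> z = 0" by blast
    then have "\<forall>\<eta>\<in>F. X \<eta> z = 0" using U_zero zero by (metis DiffI)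
    with z show ?thesis by blast
  next
    case False
    \<comment> \<open>Here \<open>U \<xi>\<close> is injective and all other members are singular.
      Such a singular \<open>\<eta>\<close> falls under the first alternative, whose common kernel
      vector contradicts the injectivity of \<open>U \<xi>\<close>.\<close>
    then have inj: "\<forall>z. U \<xi> z = 0 \<longrightarrow> z = 0" and ker: "\<forall>\<eta>\<in>M-{\<xi>}. \<exists>z. z \<noteq> 0 \<and> U \<eta> z = 0"
      using alt[OF \<xi>] by blast+
    \<comment> \<open>For a single operator, equality in the row bound would read 0 = 1.\<close>
    have "M - {\<xi>} \<noteq> {}"
    proof
      assume empty: "M - {\<xi>} = {}"
      have "(\<Sum>\<eta>\<in>M-{\<xi>}. c \<xi> \<eta>) = real (card (M - {\<xi>})) + 1"
        using quad(2)[of \<xi>] x_pos eq \<xi> unfolding K N by simp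
      then show False unfolding empty by simp
    qed
    then obtain \<eta> where \<eta>: "\<eta> \<in> M" "\<eta> \<noteq> \<xi>" by blast
    then have "\<not> (\<forall>z. U \<eta> z = 0 \<longrightarrow> z = 0)" using ker by blast
    with alt[OF \<eta>(1)] have "\<exists>z. z \<noteq> 0 \<and> U \<xi> z = 0" using \<xi> \<eta> by blast
    with inj show ?thesis by blast
  qed
qed

section \<open>Shape operators and the DDVV inequality for a form\<close>

lemma linear_shape_operator_right:
  shows "shape_operator \<beta> (\<xi> + \<eta>) x = shape_operator \<beta> \<xi> x + shape_operator \<beta> \<eta> x"
    and "shape_operator \<beta> (a *\<^sub>R \<xi>) x = a *\<^sub>R shape_operator \<beta> \<xi> x"
  by (simp_all add: shape_operator_def operator_of_form_def inner_add_right scaleR_add_left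
      sum.distrib scaleR_sum_right)

lemma self_adjoint_shape_operator:
  assumes "symmetric_bilinear \<beta>"
  shows "self_adjoint (shape_operator \<beta> \<xi>)"
proof -
  have bil: "bilinear \<beta>" and sym: "\<And>x y. \<beta> x y = \<beta> y x"
    using assms by (auto simp: symmetric_bilinear_def)
  have "shape_operator \<beta> \<xi> x \<bullet> y = x \<bullet> shape_operator \<beta> \<xi> y" for x y
    using shape_operator_inner[OF bil] sym by (metis inner_commute)
  moreover have "linear (shape_operator \<beta> \<xi>)"
    using bil unfolding shape_operator_def operator_of_form_def bilinear_def linear_iff
    by (simp add: inner_add_left scaleR_add_left sum.distrib scaleR_sum_right)
  ultimately show ?thesis by (simp add: self_adjoint_def)
qed

lemma hs_inner_shape_operator:
  assumes "bilinear \<beta>"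
  shows "hs_inner (shape_operator \<beta> \<xi>) (shape_operator \<beta> \<eta>)
    = (\<Sum>e\<in>Basis. \<Sum>f\<in>Basis. (\<beta> e f \<bullet> \<xi>) * (\<beta> e f \<bullet> \<eta>))"
  unfolding hs_inner_def
  by (intro sum.cong refl)
     (subst euclidean_inner, simp add: shape_operator_inner[OF assms])

text \<open>Neither \<open>K\<close> nor \<open>N\<close> depends on the orthonormal basis of the
  normal space, so one can be taken in which the shape operators are pairwise orthogonal. A vector
  killed by all of them is a kernel vector of \<open>\<beta>\<close>.\<close>

theorem DDVV:
  fixes \<beta> :: "'a::euclidean_space \<Rightarrow> 'a \<Rightarrow> 'b::euclidean_space"
  assumes \<beta>: "symmetric_bilinear \<beta>"
  defines "K \<equiv> \<Sum>\<xi>\<in>Basis. \<Sum>\<eta>\<in>Basis. hs_inner (commutator (shape_operator \<beta> \<xi>) (shape_operator \<beta> \<eta>))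
       (commutator (shape_operator \<beta> \<xi>) (shape_operator \<beta> \<eta>))"
    and "N \<equiv> \<Sum>e\<in>Basis. \<Sum>f\<in>Basis. (norm (\<beta> e f))\<^sup>2"
  shows "K \<le> N\<^sup>2"
    and "K = N\<^sup>2 \<Longrightarrow> N \<noteq> 0 \<Longrightarrow> DIM('a) \<ge> 3 \<Longrightarrow> \<exists>z. z \<noteq> 0 \<and> (\<forall>x. \<beta> z x = 0)"
proof -
  have bil: "bilinear \<beta>" using \<beta> by (simp add: symmetric_bilinear_def)
  define X where "X = shape_operator \<beta>"
  have X: "self_adjoint (X \<xi>)" for \<xi> unfolding X_def by (rule self_adjoint_shape_operator[OF \<beta>])
  have X_add: "X (\<xi> + \<eta>) x = X \<xi> x + X \<eta> x" and X_scaleR: "X (a *\<^sub>R \<xi>) x = a *\<^sub>R X \<xi> x" for \<xi> \<eta> a x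
    unfolding X_def by (rule linear_shape_operator_right)+
  have X_lin: "X \<xi> (x + y) = X \<xi> x + X \<xi> y" "X \<xi> (a *\<^sub>R x) = a *\<^sub>R X \<xi> x" for \<xi> x y a
    using X[of \<xi>] by (auto simp: self_adjoint_def linear_iff)
  \<comment> \<open>\<open>G\<close> represents the Gram form of the shape operators, so its
    eigenbasis is the required rotation of the normal basis.\<close>
  define G where "G \<xi> = (\<Sum>e\<in>Basis. \<Sum>f\<in>Basis. (\<beta> e f \<bullet> \<xi>) *\<^sub>R \<beta> e f)" for \<xi>
  have G_inner: "G \<xi> \<bullet> \<eta> = hs_inner (X \<xi>) (X \<eta>)" for \<xi> \<eta>
    unfolding X_def by (simp add: G_def inner_sum_left hs_inner_shape_operator[OF bil])
  have "linear G"
    unfolding linear_iff G_def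
    by (simp add: inner_add_right scaleR_add_left sum.distrib scaleR_sum_right)
  moreover have "G \<xi> \<bullet> \<eta> = \<xi> \<bullet> G \<eta>" for \<xi> \<eta>
    by (metis G_inner hs_inner_commute inner_commute)
  ultimately obtain F where F: "orthonormal_basis F" "\<And>\<xi>. \<xi> \<in> F \<Longrightarrow> G \<xi> = (G \<xi> \<bullet> \<xi>) *\<^sub>R \<xi>"
    using self_adjoint_diagonalizable by blast
  have orth: "hs_inner (X \<xi>) (X \<eta>) = 0" if "\<xi> \<in> F" "\<eta> \<in> F" "\<xi> \<noteq> \<eta>" for \<xi> \<eta>
    using F(2)[OF that(1)] orthonormal_basis_inner[OF F(1) that(1,2)] that(3)
    by (metis G_inner inner_scaleR_left mult_zero_right)
  \<comment> \<open>With one normal index frozen the expression is bilinear in the other, so the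
    basis can be changed in one index at a time.\<close>
  have bil_comm: "bilinear (\<lambda>\<xi> \<xi>'. hs_inner (commutator (X \<xi>) (X \<eta>)) (commutator (X \<xi>') (X \<eta>)))" for \<eta>
    unfolding bilinear_def linear_iff hs_inner_def commutator_def
    by (simp add: X_add X_scaleR X_lin inner_add_left inner_add_right inner_diff_left inner_diff_right
        sum.distrib sum_subtractf sum_distrib_left algebra_simps)
  let ?C = "\<lambda>\<xi> \<eta>. hs_inner (commutator (X \<xi>) (X \<eta>)) (commutator (X \<xi>) (X \<eta>))"
  have C_left: "(\<Sum>\<xi>\<in>Basis. ?C \<xi> \<eta>) = (\<Sum>\<xi>\<in>F. ?C \<xi> \<eta>)" for \<eta>
    by (rule orthonormal_basis_sum[OF F(1) bil_comm, symmetric])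
  have C_right: "(\<Sum>\<eta>\<in>Basis. ?C \<xi> \<eta>) = (\<Sum>\<eta>\<in>F. ?C \<xi> \<eta>)" for \<xi>
    using C_left[of \<xi>] by (simp add: hs_inner_commutator_swap[of "X \<xi>"])
  have K: "K = (\<Sum>\<xi>\<in>F. \<Sum>\<eta>\<in>F. ?C \<xi> \<eta>)"
  proof -
    have "K = (\<Sum>\<xi>\<in>Basis. \<Sum>\<eta>\<in>F. ?C \<xi> \<eta>)"
      unfolding K_def X_def[symmetric] by (intro sum.cong refl C_right)
    also have "\<dots> = (\<Sum>\<eta>\<in>F. \<Sum>\<xi>\<in>F. ?C \<xi> \<eta>)"
      by (subst sum.swap) (intro sum.cong refl C_left)
    finally show ?thesis by (subst sum.swap)
  qed
  have N: "N = (\<Sum>\<xi>\<in>F. hs_inner (X \<xi>) (X \<xi>))"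
  proof -
    have "(norm (\<beta> e f))\<^sup>2 = (\<Sum>\<xi>\<in>F. (\<beta> e f \<bullet> \<xi>) * (\<beta> e f \<bullet> \<xi>))" for e f
      using orthonormal_basis_Parseval[OF F(1), of "\<beta> e f" "\<beta> e f"] by (simp add: power2_norm_eq_inner)
    then show ?thesis
      unfolding N_def X_def hs_inner_shape_operator[OF bil]
      by (simp only: sum.swap[where A = F and B = Basis])
  qed
  note ddvv = DDVV_orthogonal[of F X, OF orthonormal_basis_finite[OF F(1)] X orth, folded K N]
  from ddvv(1) show "K \<le> N\<^sup>2" .
  assume "K = N\<^sup>2" "N \<noteq> 0" "DIM('a) \<ge> 3"
  then obtain z where z: "z \<noteq> 0" "\<And>\<xi>. \<xi> \<in> F \<Longrightarrow> X \<xi> z = 0" using ddvv(2) by blast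
  have "\<beta> z x = 0" for x
  proof -
    have "\<beta> z x \<bullet> \<xi> = 0" if "\<xi> \<in> F" for \<xi>
      using shape_operator_inner[OF bil, of \<xi> z x] z(2)[OF that] by (simp add: X_def)
    then show ?thesis using orthonormal_basis_expansion[OF F(1), of "\<beta> z x"] by simp
  qed
  with z(1) show "\<exists>z. z \<noteq> 0 \<and> (\<forall>x. \<beta> z x = 0)" by blast
qed

subsection \<open>Curvature of a symmetric bilinear form\<close>

lemma sorted_partial_average_le:
  fixes xs :: "real list"
  assumes "sorted xs" and k: "0 < k" "k < length xs"
  shows "sum_list (take k xs) / k \<le> sum_list xs / length xs"
    and "sum_list (take k xs) / k = sum_list xs / length xs \<Longrightarrow> \<exists>l. set xs \<subseteq> {l}"
proof -
  \<comment> \<open>\<open>xs ! k\<close> is the first entry after the initial \<open>k\<close>: it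
    bounds those from above and the remaining ones from below.\<close>
  define n l where "n = length xs" and "l = xs ! k"
  have kn: "k < n" using k by (simp add: n_def)
  have low: "x \<le> l" if "x \<in> set (take k xs)" for x
    using that assms unfolding l_def by (auto simp: in_set_conv_nth intro!: sorted_nth_mono)
  have high: "l \<le> x" if "x \<in> set (drop k xs)" for x
    using that assms unfolding l_def by (auto simp: in_set_conv_nth intro!: sorted_nth_mono)
  have sum_low: "sum_list ys \<le> length ys * l" if "\<And>x. x \<in> set ys \<Longrightarrow> x \<le> l" for ys
    using that by (induction ys) (force simp: algebra_simps)+
  have sum_high: "length ys * l \<le> sum_list ys" if "\<And>x. x \<in> set ys \<Longrightarrow> l \<le> x" for ys
    using that by (induction ys) (force simp: algebra_simps)+
  have sum_low_eq: "set ys \<subseteq> {l}" if "\<And>x. x \<in> set ys \<Longrightarrow> x \<le> l" "length ys * l \<le> sum_list ys" for ys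
    using that
  proof (induction ys)
    case (Cons y ys)
    have "y \<le> l" "sum_list ys \<le> length ys * l" using Cons(2) sum_low[of ys] by auto
    then have "length ys * l \<le> sum_list ys" "y = l" using Cons(3) by (auto simp: algebra_simps)
    then show ?case using Cons by auto
  qed simp
  have sum_high_eq: "set ys \<subseteq> {l}" if "\<And>x. x \<in> set ys \<Longrightarrow> l \<le> x" "sum_list ys \<le> length ys * l" for ys
    using that
  proof (induction ys)
    case (Cons y ys)
    have "l \<le> y" "length ys * l \<le> sum_list ys" using Cons(2) sum_high[of ys] by auto
    then have "sum_list ys \<le> length ys * l" "y = l" using Cons(3) by (auto simp: algebra_simps)
    then show ?case using Cons by auto
  qed simp
  define A B where "A = sum_list (take k xs)" and "B = sum_list (drop k xs)"
  have A: "A \<le> k * l" using sum_low[of "take k xs"] low k by (simp add: A_def)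
  have B: "(real n - k) * l \<le> B"
    using sum_high[of "drop k xs"] high k by (simp add: B_def n_def of_nat_diff)
  have AB: "sum_list xs = A + B"
    unfolding A_def B_def by (metis append_take_drop_id sum_list.append)
  \<comment> \<open>The difference of the averages, cleared of denominators, is a sum of two
    nonnegative terms; equality makes both vanish and the list constant.\<close>
  have diff: "k * (A + B) - n * A = k * (B - (real n - k) * l) + (real n - k) * (k * l - A)"
    by (simp add: algebra_simps)
  have nn: "0 \<le> k * (B - (real n - k) * l)" "0 \<le> (real n - k) * (k * l - A)"
    using A B kn by (intro mult_nonneg_nonneg; simp)+
  have pos: "real k > 0" "real n > 0" using k kn by auto
  show "sum_list (take k xs) / k \<le> sum_list xs / length xs"
    using nn diff pos unfolding AB A_def[symmetric] n_def[symmetric] by (simp add: field_simps)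
  assume "sum_list (take k xs) / k = sum_list xs / length xs"
  then have "k * (A + B) - n * A = 0"
    using pos unfolding AB A_def[symmetric] n_def[symmetric] by (simp add: field_simps)
  with nn diff have "k * (B - (real n - k) * l) = 0" "(real n - k) * (k * l - A) = 0" by linarith+
  then have "B = (real n - k) * l" "A = k * l" using pos kn by auto
  then have "set (take k xs) \<subseteq> {l}" "set (drop k xs) \<subseteq> {l}"
    using sum_low_eq[of "take k xs"] sum_high_eq[of "drop k xs"] low high k
    by (auto simp: A_def B_def n_def of_nat_diff)
  then have "set xs \<subseteq> {l}" by (metis Un_least append_take_drop_id set_append)
  then show "\<exists>l. set xs \<subseteq> {l}" by blast
qed

section \<open>The traceless part of a form and its Ricci tensor\<close>

definition traceless_part ::
  "('a::euclidean_space \<Rightarrow> 'a \<Rightarrow> 'b::euclidean_space) \<Rightarrow> 'a \<Rightarrow> 'a \<Rightarrow> 'b" where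
  "traceless_part \<beta> x y = \<beta> x y - (x \<bullet> y) *\<^sub>R mean_curvature_vector \<beta>"

definition form_norm2 :: "('a::euclidean_space \<Rightarrow> 'a \<Rightarrow> 'b::euclidean_space) \<Rightarrow> real" where
  "form_norm2 \<beta> = (\<Sum>e\<in>Basis. \<Sum>f\<in>Basis. (norm (\<beta> e f))\<^sup>2)"

lemma symmetric_bilinear_traceless_part:
  assumes "symmetric_bilinear \<beta>"
  shows "symmetric_bilinear (traceless_part \<beta>)"
  using assms unfolding symmetric_bilinear_def bilinear_def linear_iff traceless_part_def
  by (simp add: inner_add_left inner_add_right inner_commute algebra_simps)

lemma traceless_part_trace: "(\<Sum>e\<in>Basis. traceless_part \<beta> e e) = 0"
  for \<beta> :: "'a::euclidean_space \<Rightarrow> 'a \<Rightarrow> 'b::euclidean_space"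
  by (simp add: traceless_part_def sum_subtractf mean_curvature_vector_def sum_constant_scaleR)

lemma form_norm2_nonneg: "0 \<le> form_norm2 \<beta>"
  by (simp add: form_norm2_def sum_nonneg)

lemma umbilical_iff_form_norm2_eq_0:
  assumes "symmetric_bilinear \<beta>"
  shows "umbilical \<beta> \<longleftrightarrow> form_norm2 (traceless_part \<beta>) = 0"
proof
  assume "umbilical \<beta>"
  then show "form_norm2 (traceless_part \<beta>) = 0"
    by (simp add: form_norm2_def traceless_part_def umbilical_def)
next
  assume 0: "form_norm2 (traceless_part \<beta>) = 0"
  have bil: "bilinear (traceless_part \<beta>)"
    using symmetric_bilinear_traceless_part[OF assms] by (simp add: symmetric_bilinear_def)
  have "(\<Sum>f\<in>Basis. (norm (traceless_part \<beta> e f))\<^sup>2) = 0" if "e \<in> Basis" for e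
    using 0 that unfolding form_norm2_def
    by (subst (asm) sum_nonneg_eq_0_iff) (auto intro!: sum_nonneg)
  then have "traceless_part \<beta> e f = 0" if "e \<in> Basis" "f \<in> Basis" for e f
    using that by (simp add: sum_nonneg_eq_0_iff)
  then have "traceless_part \<beta> x y = 0" for x y
    using bilinear_eq[OF bil, of "\<lambda>x y. 0" UNIV Basis UNIV Basis]
    by (simp add: bilinear_def linear_iff)
  then show "umbilical \<beta>" by (simp add: umbilical_def traceless_part_def)
qed

text \<open>Removing the trace changes each shape operator by a multiple of the identity, which
  commutes with every linear operator.\<close>

lemma commutator_shape_operator_traceless:
  assumes "bilinear \<beta>"
  shows "commutator (shape_operator \<beta> \<xi>) (shape_operator \<beta> \<eta>)
    = commutator (shape_operator (traceless_part \<beta>) \<xi>) (shape_operator (traceless_part \<beta>) \<eta>)"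
proof -
  have shape: "shape_operator \<beta> \<xi> x
      = shape_operator (traceless_part \<beta>) \<xi> x + (mean_curvature_vector \<beta> \<bullet> \<xi>) *\<^sub>R x" for \<xi> x
  proof -
    have "shape_operator \<beta> \<xi> x = (\<Sum>e\<in>Basis. (traceless_part \<beta> x e \<bullet> \<xi>) *\<^sub>R e)
        + (mean_curvature_vector \<beta> \<bullet> \<xi>) *\<^sub>R (\<Sum>e\<in>Basis. (x \<bullet> e) *\<^sub>R e)"
      by (simp add: shape_operator_def operator_of_form_def traceless_part_def inner_diff_left
          scaleR_diff_left sum_subtractf scaleR_sum_right mult.commute)
    then show ?thesis
      unfolding euclidean_representation by (simp add: shape_operator_def operator_of_form_def)
  qed
  have lin: "linear (shape_operator (traceless_part \<beta>) \<xi>)" for \<xi>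
    using assms
    unfolding shape_operator_def operator_of_form_def traceless_part_def bilinear_def linear_iff
    by (simp add: inner_add_left inner_diff_left scaleR_add_left scaleR_diff_left
        sum.distrib sum_subtractf scaleR_sum_right algebra_simps)
  show ?thesis
    by (rule ext) (simp add: commutator_def shape linear_add[OF lin] linear_cmul[OF lin] algebra_simps)
qed

lemma normal_scalar_curvature_eq:
  fixes \<beta> :: "'a::euclidean_space \<Rightarrow> 'a \<Rightarrow> 'b::euclidean_space"
  assumes "bilinear \<beta>" "DIM('a) \<ge> 2"
  shows "real DIM('a) * (real DIM('a) - 1) * normal_scalar_curvature \<beta> =
    sqrt (\<Sum>\<xi>\<in>Basis. \<Sum>\<eta>\<in>Basis.
      hs_inner (commutator (shape_operator (traceless_part \<beta>) \<xi>) (shape_operator (traceless_part \<beta>) \<eta>))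
        (commutator (shape_operator (traceless_part \<beta>) \<xi>) (shape_operator (traceless_part \<beta>) \<eta>)))"
proof -
  let ?C = "\<lambda>\<xi> \<eta>. commutator (shape_operator (traceless_part \<beta>) \<xi>) (shape_operator (traceless_part \<beta>) \<eta>)"
  have "(\<Sum>e\<in>Basis. \<Sum>f\<in>Basis. \<Sum>\<xi>\<in>Basis. \<Sum>\<eta>\<in>Basis. (?C \<xi> \<eta> e \<bullet> f)\<^sup>2)
      = (\<Sum>\<xi>\<in>Basis. \<Sum>\<eta>\<in>Basis. \<Sum>e\<in>Basis. \<Sum>f\<in>Basis. (?C \<xi> \<eta> e \<bullet> f)\<^sup>2)"
    by (simp only: sum.swap[where A = "Basis :: 'a set" and B = "Basis :: 'b set"])
  also have "\<dots> = (\<Sum>\<xi>\<in>Basis. \<Sum>\<eta>\<in>Basis. hs_inner (?C \<xi> \<eta>) (?C \<xi> \<eta>))"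
    unfolding hs_inner_def
    by (intro sum.cong refl, subst euclidean_inner) (simp add: power2_eq_square)
  finally show ?thesis
    using assms(2)
    by (simp add: normal_scalar_curvature_def commutator_shape_operator_traceless[OF assms(1)])
qed

text \<open>In the coefficient n - 2, the n comes from the trace of \<open>\<beta>\<close> and the 2
  from the cross terms of the contracted square. On a kernel vector of the traceless part only the
  first summand survives.\<close>

lemma formal_ricci_eq:
  fixes \<beta> :: "'a::euclidean_space \<Rightarrow> 'a \<Rightarrow> 'b::euclidean_space"
  assumes "symmetric_bilinear \<beta>"
  shows "formal_ricci c \<beta> x y = (real DIM('a) - 1) * (c + (mean_curvature \<beta>)\<^sup>2) * (x \<bullet> y)
    + (real DIM('a) - 2) * (mean_curvature_vector \<beta> \<bullet> traceless_part \<beta> x y)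
    - (\<Sum>e\<in>Basis. traceless_part \<beta> e x \<bullet> traceless_part \<beta> e y)"
proof -
  define H where "H = mean_curvature_vector \<beta>"
  define \<phi> where "\<phi> = traceless_part \<beta>"
  have \<beta>: "\<beta> x y = \<phi> x y + (x \<bullet> y) *\<^sub>R H" for x y by (simp add: \<phi>_def traceless_part_def H_def)
  have sym: "\<phi> x y = \<phi> y x" for x y
    using symmetric_bilinear_traceless_part[OF assms] by (simp add: symmetric_bilinear_def \<phi>_def)
  have lin: "linear (\<phi> x)" for x
    using symmetric_bilinear_traceless_part[OF assms]
    by (simp add: symmetric_bilinear_def \<phi>_def bilinear_def)
  have tr: "(\<Sum>e\<in>Basis. \<phi> e e) = 0" unfolding \<phi>_def by (rule traceless_part_trace)
  \<comment> \<open>Summing over the basis against \<open>e \<bullet> x\<close> replaces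
    \<open>e\<close> by \<open>x\<close>; this evaluates the cross terms.\<close>
  have contract: "(\<Sum>e\<in>Basis. (e \<bullet> x) *\<^sub>R \<phi> e y) = \<phi> x y" for x y
  proof -
    have "(\<Sum>e\<in>Basis. (e \<bullet> x) *\<^sub>R \<phi> e y) = \<phi> y (\<Sum>e\<in>Basis. (x \<bullet> e) *\<^sub>R e)"
      by (simp add: linear_sum[OF lin] linear_cmul[OF lin] inner_commute[of _ x] sym[of _ y])
    then show ?thesis by (simp add: euclidean_representation sym[of y])
  qed
  have contract_inner: "(\<Sum>e\<in>Basis. (e \<bullet> x) * (\<phi> e y \<bullet> H)) = \<phi> x y \<bullet> H" for x y
    unfolding contract[of x y, symmetric] by (simp add: inner_sum_left)
  have xy: "(\<Sum>e\<in>Basis. (e \<bullet> x) * (e \<bullet> y)) = x \<bullet> y"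
    by (subst euclidean_inner) (simp add: inner_commute)
  have H2: "(mean_curvature \<beta>)\<^sup>2 = H \<bullet> H"
    by (simp add: mean_curvature_def H_def power2_norm_eq_inner)
  have first: "(\<Sum>e\<in>Basis. \<beta> e e \<bullet> \<beta> x y) = real DIM('a) * (H \<bullet> \<phi> x y + (x \<bullet> y) * (H \<bullet> H))"
  proof -
    have "(\<Sum>e\<in>Basis. \<beta> e e) = real DIM('a) *\<^sub>R H" by (simp add: H_def mean_curvature_vector_def)
    then have "(\<Sum>e\<in>Basis. \<beta> e e \<bullet> \<beta> x y) = real DIM('a) * (H \<bullet> \<beta> x y)"
      by (simp flip: inner_sum_left)
    then show ?thesis by (simp add: inner_add_right \<beta>[of x y])
  qed
  have second: "(\<Sum>e\<in>Basis. \<beta> e y \<bullet> \<beta> e x)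
      = (\<Sum>e\<in>Basis. \<phi> e x \<bullet> \<phi> e y) + 2 * (H \<bullet> \<phi> x y) + (x \<bullet> y) * (H \<bullet> H)"
  proof -
    have "\<beta> e y \<bullet> \<beta> e x = \<phi> e x \<bullet> \<phi> e y + (e \<bullet> x) * (\<phi> e y \<bullet> H) + (e \<bullet> y) * (\<phi> e x \<bullet> H)
        + (e \<bullet> x) * (e \<bullet> y) * (H \<bullet> H)" for e
      unfolding \<beta>[of e] inner_add_left inner_add_right
      by (simp add: inner_commute[of H "\<phi> e x"] inner_commute[of "\<phi> e y" "\<phi> e x"] algebra_simps)
    then show ?thesis
      by (simp add: sum.distrib contract_inner xy sym[of y x] inner_commute[of H "\<phi> x y"] flip: sum_distrib_right)
  qed
  have "formal_ricci c \<beta> x y = (\<Sum>e\<in>Basis. c * (x \<bullet> y) - c * ((e \<bullet> x) * (e \<bullet> y)) + \<beta> e e \<bullet> \<beta> x y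
      - \<beta> e y \<bullet> \<beta> e x)"
    using assms unfolding formal_ricci_def formal_curvature_def symmetric_bilinear_def
    by (intro sum.cong refl) (simp add: inner_commute[of x] algebra_simps)
  also have "\<dots> = real DIM('a) * (c * (x \<bullet> y)) - c * (x \<bullet> y)
      + (\<Sum>e\<in>Basis. \<beta> e e \<bullet> \<beta> x y) - (\<Sum>e\<in>Basis. \<beta> e y \<bullet> \<beta> e x)"
    by (simp add: sum.distrib sum_subtractf xy flip: sum_distrib_left)
  finally show ?thesis
    unfolding first second H2 H_def[symmetric] \<phi>_def[symmetric] by (simp add: algebra_simps)
qed

lemma self_adjoint_ricci_operator:
  fixes \<beta> :: "'a::euclidean_space \<Rightarrow> 'a \<Rightarrow> 'b::euclidean_space"
  assumes "symmetric_bilinear \<beta>"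
  shows "self_adjoint (ricci_operator c \<beta>)"
proof -
  have bil: "bilinear \<beta>" and sym: "\<And>x y. \<beta> x y = \<beta> y x"
    using assms by (auto simp: symmetric_bilinear_def)
  have ric_sym: "formal_ricci c \<beta> x y = formal_ricci c \<beta> y x" for x y
  proof -
    have "formal_curvature c \<beta> e x e y = formal_curvature c \<beta> e y e x" for e
      unfolding formal_curvature_def sym[of x y] sym[of x e] sym[of y e]
        inner_commute[of x y] inner_commute[of x e] inner_commute[of y e]
        inner_commute[of "\<beta> e x" "\<beta> e y"] by simp
    then show ?thesis by (simp add: formal_ricci_def)
  qed
  have sa: "ricci_operator c \<beta> x \<bullet> y = x \<bullet> ricci_operator c \<beta> y" for x y
    using ric_sym[of x y]
    by (simp add: ricci_operator_inner[OF bil] inner_commute[of x "ricci_operator c \<beta> y"])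
  have "linear (ricci_operator c \<beta>)"
    by (rule linearI; rule vector_eq_rdot[THEN iffD1])
       (simp_all add: sa inner_add_left inner_add_right)
  with sa show ?thesis by (simp add: self_adjoint_def)
qed

text \<open>The middle term of \<open>formal_ricci_eq\<close> has trace zero, and the last one sums
  to the squared norm.\<close>

lemma ricci_operator_trace:
  fixes \<beta> :: "'a::euclidean_space \<Rightarrow> 'a \<Rightarrow> 'b::euclidean_space"
  assumes "symmetric_bilinear \<beta>" "DIM('a) \<ge> 2"
  shows "(\<Sum>e\<in>Basis. ricci_operator c \<beta> e \<bullet> e)
    = real DIM('a) * (c + (mean_curvature \<beta>)\<^sup>2) - form_norm2 (traceless_part \<beta>) / (real DIM('a) - 1)"
proof -
  have bil: "bilinear \<beta>" and sym: "\<And>x y. traceless_part \<beta> x y = traceless_part \<beta> y x"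
    using assms symmetric_bilinear_traceless_part[OF assms(1)] by (auto simp: symmetric_bilinear_def)
  have "(\<Sum>e\<in>Basis. formal_ricci c \<beta> e e)
    = (\<Sum>e::'a\<in>Basis. (real DIM('a) - 1) * (c + (mean_curvature \<beta>)\<^sup>2))
      + (real DIM('a) - 2) * (mean_curvature_vector \<beta> \<bullet> (\<Sum>e\<in>Basis. traceless_part \<beta> e e))
      - (\<Sum>e\<in>Basis. \<Sum>f\<in>Basis. (norm (traceless_part \<beta> f e))\<^sup>2)"
    by (simp add: formal_ricci_eq[OF assms(1)] sum.distrib sum_subtractf inner_sum_right
        sum_distrib_left power2_norm_eq_inner)
  then have "(\<Sum>e\<in>Basis. formal_ricci c \<beta> e e)
    = real DIM('a) * ((real DIM('a) - 1) * (c + (mean_curvature \<beta>)\<^sup>2)) - form_norm2 (traceless_part \<beta>)"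
    by (subst (asm) sum.swap) (simp add: traceless_part_trace form_norm2_def)
  then show ?thesis
    using assms(2) by (simp add: ricci_operator_inner[OF bil] field_simps flip: sum_divide_distrib)
qed

lemma partial_scalar_curvature_eq:
  fixes \<beta> :: "'a::euclidean_space \<Rightarrow> 'a \<Rightarrow> 'b::euclidean_space"
  assumes "length (eigenvalue_list (ricci_operator c \<beta>)) = DIM('a)" "k \<le> DIM('a)"
  shows "partial_scalar_curvature c \<beta> k = sum_list (take k (eigenvalue_list (ricci_operator c \<beta>))) / k"
proof -
  let ?xs = "eigenvalue_list (ricci_operator c \<beta>)"
  \<comment> \<open>Eigenvalues are numbered from 1, list entries from 0.\<close>
  have "(\<Sum>i=1..k. ?xs ! (i - 1)) = (\<Sum>i<k. ?xs ! i)"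
    by (rule sum.reindex_bij_witness[of _ Suc "\<lambda>i. i - 1"]) auto
  also have "\<dots> = sum_list (take k ?xs)"
    using assms by (simp add: sum_list_sum_nth lessThan_atLeast0 min_def)
  finally show ?thesis by (simp add: partial_scalar_curvature_def ricci_eigenvalue_def)
qed

section \<open>Averages of Ricci eigenvalues against the normal scalar curvature\<close>

theorem proposition8:
  fixes \<beta> :: "'a::euclidean_space \<Rightarrow> 'a \<Rightarrow> 'b::euclidean_space" and c :: real
  assumes "DIM('a) \<ge> 2" and "symmetric_bilinear \<beta>"
  shows "(DIM('a) \<ge> 3 \<longrightarrow>
            (\<forall>k\<in>{1..DIM('a) - 1}. partial_scalar_curvature c \<beta> k
               \<le> c + (mean_curvature \<beta>)\<^sup>2 - normal_scalar_curvature \<beta>) \<and>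
            ((\<exists>k\<in>{1..DIM('a) - 1}. partial_scalar_curvature c \<beta> k
               = c + (mean_curvature \<beta>)\<^sup>2 - normal_scalar_curvature \<beta>) \<longleftrightarrow> umbilical \<beta>)) \<and>
         (\<forall>l\<in>{0..<1::real}. scalar_curvature c \<beta>
               \<le> c + (mean_curvature \<beta>)\<^sup>2 - l * normal_scalar_curvature \<beta>) \<and>
         ((\<exists>l\<in>{0..<1::real}. scalar_curvature c \<beta>
               = c + (mean_curvature \<beta>)\<^sup>2 - l * normal_scalar_curvature \<beta>) \<longleftrightarrow> umbilical \<beta>)"
proof -
  define n where "n = DIM('a)"
  define \<phi> where "\<phi> = traceless_part \<beta>"
  define N where "N = form_norm2 \<phi>"
  define m where "m = real n * (real n - 1)"
  define h where "h = c + (mean_curvature \<beta>)\<^sup>2"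
  define T where "T = ricci_operator c \<beta>"
  define xs where "xs = eigenvalue_list T"
  define D where "D = normal_scalar_curvature \<beta>"
  let ?C = "\<lambda>\<xi> \<eta>. commutator (shape_operator \<phi> \<xi>) (shape_operator \<phi> \<eta>)"
  define K where "K = (\<Sum>\<xi>\<in>Basis. \<Sum>\<eta>\<in>Basis. hs_inner (?C \<xi> \<eta>) (?C \<xi> \<eta>))"
  have n: "n \<ge> 2" using assms(1) by (simp add: n_def)
  then have m: "m > 0" by (simp add: m_def)
  have bil: "bilinear \<beta>" using assms(2) by (simp add: symmetric_bilinear_def)
  have \<phi>: "symmetric_bilinear \<phi>" unfolding \<phi>_def by (rule symmetric_bilinear_traceless_part) fact
  have N: "0 \<le> N" by (simp add: N_def form_norm2_nonneg)
  have umb: "umbilical \<beta> \<longleftrightarrow> N = 0"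
    unfolding N_def \<phi>_def by (rule umbilical_iff_form_norm2_eq_0) fact
  have T: "linear T" "\<And>x y. T x \<bullet> y = x \<bullet> T y"
    using self_adjoint_ricci_operator[OF assms(2)] by (auto simp: self_adjoint_def T_def)
  have len: "length xs = n" unfolding xs_def n_def by (rule eigenvalue_list_trace(1)[OF T])
  have total: "sum_list xs = n * (h - N / m)"
  proof -
    have "sum_list xs = (\<Sum>e\<in>Basis. T e \<bullet> e)"
      unfolding xs_def by (rule eigenvalue_list_trace(2)[OF T])
    also have "\<dots> = n * h - N / (real n - 1)"
      unfolding T_def h_def N_def \<phi>_def n_def by (rule ricci_operator_trace[OF assms(2,1)])
    also have "N / (real n - 1) = n * (N / m)" using n by (simp add: m_def)
    finally show ?thesis by (simp only: right_diff_distrib)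
  qed
  have psc: "partial_scalar_curvature c \<beta> k = sum_list (take k xs) / k" if "k \<le> n" for k
    using partial_scalar_curvature_eq[of c \<beta> k] len that by (simp add: xs_def T_def n_def)
  have sc: "scalar_curvature c \<beta> = h - N / m"
    using psc[of n] len total n by (simp add: scalar_curvature_def flip: n_def)
  have D: "m * D = sqrt K"
    using normal_scalar_curvature_eq[OF bil assms(1)]
    by (simp add: m_def D_def K_def \<phi>_def n_def)
  \<comment> \<open>Divided by \<open>m\<close>, the DDVV inequality for the traceless part bounds
    \<open>D\<close> by \<open>N / m\<close>, the defect of the scalar curvature in
    \<open>sc\<close>.\<close>
  have "K \<le> N\<^sup>2" unfolding K_def N_def form_norm2_def by (rule DDVV(1)[OF \<phi>])
  then have "m * D \<le> N" unfolding D using N by (simp add: real_le_lsqrt)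
  then have D_le: "D \<le> N / m" using m by (simp add: field_simps)
  have K_nonneg: "0 \<le> K" unfolding K_def by (intro sum_nonneg hs_inner_nonneg)
  then have "0 \<le> m * D" unfolding D by simp
  then have D_nonneg: "0 \<le> D" using m by (simp add: zero_le_mult_iff)
  \<comment> \<open>In the umbilical case the Ricci operator is \<open>h\<close> times the identity,
    and \<open>D\<close> is squeezed between 0 and \<open>N / m = 0\<close>.\<close>
  have umb_const: "partial_scalar_curvature c \<beta> k = h \<and> D = 0" if "N = 0" "k \<in> {1..n-1}" for k
  proof -
    have "T x = h *\<^sub>R x" for x
    proof -
      have "traceless_part \<beta> x y = 0" for x y
        using umb \<open>N = 0\<close> by (simp add: umbilical_def traceless_part_def)
      then have "T x \<bullet> y = (h *\<^sub>R x) \<bullet> y" for y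
        using n unfolding T_def ricci_operator_inner[OF bil] formal_ricci_eq[OF assms(2)]
        by (simp add: h_def n_def)
      then show ?thesis by (metis vector_eq_rdot)
    qed
    then have ev: "eigenvalues T \<subseteq> {h}" by (auto simp: eigenvalues_def)
    moreover have "finite (eigenvalues T)" by (rule finite_subset[OF ev]) simp
    ultimately have "set xs \<subseteq> {h}"
      unfolding xs_def eigenvalue_list_def by (auto simp: subset_iff)
    then have "set (take k xs) \<subseteq> {h}" by (meson order_trans set_take_subset)
    then have "take k xs = replicate k h"
      using len that(2) by (intro replicate_eqI) auto
    then show ?thesis
      using psc[of k] that D_le D_nonneg by (auto simp: sum_list_replicate)
  qed
  have avg: "partial_scalar_curvature c \<beta> k \<le> h - N / m" if "k \<in> {1..n-1}" for k
  proof -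
    have "sum_list (take k xs) / k \<le> sum_list xs / length xs"
      using that len sorted_eigenvalue_list[of T] by (intro sorted_partial_average_le) (auto simp: xs_def)
    then show ?thesis using psc[of k] that len total n by auto
  qed
  have rigid: "N = 0"
    if n3: "n \<ge> 3" and k: "k \<in> {1..n-1}" and eq: "partial_scalar_curvature c \<beta> k = h - D" for k
  proof (rule ccontr)
    assume "N \<noteq> 0"
    \<comment> \<open>Equality holds in both links of \<open>partial_scalar_curvature c \<beta> k
      \<le> h - N / m \<le> h - D\<close>.\<close>
    have tight: "D = N / m" "sum_list (take k xs) / k = sum_list xs / length xs"
      using avg[OF k] eq D_le psc[of k] k len total n by auto
    have "0 < k" "k < length xs" using k len n3 by auto
    then obtain l where "set xs \<subseteq> {l}"
      using sorted_partial_average_le(2)[of xs k] tight(2) sorted_eigenvalue_list[of T]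
      by (auto simp: xs_def)
    then have Tl: "T x = l *\<^sub>R x" for x
      using eigenvalue_list_trace(3)[OF T] by (simp add: xs_def)
    have "sqrt K = N" using D tight(1) m by simp
    then have "K = N\<^sup>2" using K_nonneg by (metis real_sqrt_pow2)
    then obtain z where z: "z \<noteq> 0" "\<And>x. \<phi> z x = 0"
      using DDVV(2)[OF \<phi>] \<open>N \<noteq> 0\<close> n3 unfolding K_def N_def form_norm2_def n_def by blast
    have "\<phi> x z = 0" for x using z(2)[of x] \<phi> by (metis symmetric_bilinear_def)
    with z(2) have "formal_ricci c \<beta> z z = (real n - 1) * h * (z \<bullet> z)"
      by (simp add: formal_ricci_eq[OF assms(2)] n_def h_def flip: \<phi>_def)
    then have "T z \<bullet> z = h * (z \<bullet> z)"
      using n by (simp add: T_def ricci_operator_inner[OF bil] n_def)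
    \<comment> \<open>The kernel vector identifies the scalar as \<open>h\<close>, while the trace
      in \<open>total\<close> gives \<open>h - N / m\<close>, which is different because
      \<open>N\<close> is nonzero.\<close>
    then have "l = h" using z(1) by (simp add: Tl)
    then have "sum_list xs = n * h"
      unfolding xs_def eigenvalue_list_trace(2)[OF T] by (simp add: Tl n_def)
    with total n m \<open>N \<noteq> 0\<close> show False by (simp add: field_simps)
  qed
  have part1: "(\<forall>k\<in>{1..n-1}. partial_scalar_curvature c \<beta> k \<le> h - D) \<and>
      ((\<exists>k\<in>{1..n-1}. partial_scalar_curvature c \<beta> k = h - D) \<longleftrightarrow> N = 0)" if "n \<ge> 3"
  proof (intro conjI iffI ballI)
    fix k assume "k \<in> {1..n-1}"
    from avg[OF this] D_le show "partial_scalar_curvature c \<beta> k \<le> h - D" by linarith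
  next
    assume "\<exists>k\<in>{1..n-1}. partial_scalar_curvature c \<beta> k = h - D"
    with rigid[OF that] show "N = 0" by blast
  next
    assume "N = 0"
    with umb_const[of 1] that show "\<exists>k\<in>{1..n-1}. partial_scalar_curvature c \<beta> k = h - D"
      by (intro bexI[of _ 1]) auto
  qed
  have l_le: "l * D \<le> D" if "l \<in> {0..<1}" for l :: real
    using that D_nonneg by (simp add: mult_left_le_one_le)
  have part2: "\<forall>l\<in>{0..<1}. scalar_curvature c \<beta> \<le> h - l * D"
    using l_le D_le sc by fastforce
  have part3: "(\<exists>l\<in>{0..<1}. scalar_curvature c \<beta> = h - l * D) \<longleftrightarrow> N = 0"
  proof
    assume "\<exists>l\<in>{0..<1}. scalar_curvature c \<beta> = h - l * D"
    then obtain l where l: "l \<in> {0..<1}" "N / m = l * D" using sc by auto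
    \<comment> \<open>\<open>D \<le> N / m = l * D\<close> with \<open>l < 1\<close> forces
      \<open>D = 0\<close>, and then \<open>N / m = l * D\<close> gives
      \<open>N = 0\<close>.\<close>
    with D_le have "D \<le> l * D" by simp
    then have "(1 - l) * D \<le> 0" by (simp add: algebra_simps)
    then have "D \<le> 0" using l(1) by (simp add: mult_le_0_iff)
    with l m D_nonneg show "N = 0" by simp
  next
    assume "N = 0"
    then show "\<exists>l\<in>{0..<1}. scalar_curvature c \<beta> = h - l * D"
      using sc by (intro bexI[of _ 0]) auto
  qed
  show ?thesis
    using part1 part2 part3 by (simp only: umb flip: h_def D_def n_def) blast
qed

end
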